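(* Let $\mathbb{K}$ be a field of characteristic zero. Any finite-dimensional quadratic symplectic Lie superalgebra $(\mathfrak{g},B,\omega)$ over $\mathbb{K}$ is nilpotent.
   Context: A Lie superalgebra is a $\mathbb{Z}_2$-graded vector space $\mathfrak{g}=\mathfrak{g}_{\bar 0}\oplus\mathfrak{g}_{\bar 1}$ with an even bilinear bracket satisfying, for homogeneous $X,Y,Z$ of degrees $x,y,z$, $[X,Y]=-(-1)^{xy}[Y,X]$ and $(-1)^{xz}[X,[Y,Z]]+(-1)^{xy}[Y,[Z,X]]+(-1)^{yz}[Z,[X,Y]]=0$. A bilinear form $F$ on $\mathfrak{g}$ is even if $F(\mathfrak{g}_{\bar 0},\mathfrak{g}_{\bar 1})=F(\mathfrak{g}_{\bar 1},\mathfrak{g}_{\bar 0})=\{0\}$. $\mathfrak{g}$ is quadratic symplectic, written $(\mathfrak{g},B,\omega)$, if it is equipped with: an invariant scalar product $B$, i.e. an even, non-degenerate bilinear form that is supersymmetric ($B(X,Y)=(-1)^{xy}B(Y,X)$) and invariant ($B([X,Y],Z)=B(X,[Y,Z])$); and a symplectic structure $\omega$, i.e. an even, non-degenerate bilinear form that is skew-supersymmetric ($\omega(X,Y)=-(-1)^{xy}\omega(Y,X)$) and a scalar $2$-cocycle ($(-1)^{xz}\omega(X,[Y,Z])+(-1)^{yx}\omega(Y,[Z,X])+(-1)^{zy}\omega(Z,[X,Y])=0$). $\mathfrak{g}$ is nilpotent if $\mathcal{C}^k(\mathfrak{g})=\{0\}$ for some $k$, where $\mathcal{C}^0(\mathfrak{g})=\mathfrak{g}$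 and $\mathcal{C}^{k+1}(\mathfrak{g})=[\mathcal{C}^k(\mathfrak{g}),\mathfrak{g}]$. *)

theory Defs
  imports Complex_Main "HOL-Library.Z2"
begin

text \<open>
  Degrees live in the two-element field \<open>bit\<close>, so that sums and products of degrees are
  taken modulo 2; \<open>koszul x y\<close> is the sign $(-1)^{xy}$.
\<close>

definition koszul :: "bit \<Rightarrow> bit \<Rightarrow> 'k::ring_1" where
  "koszul x y = (if x * y = 1 then - 1 else 1)"

locale super_vector_space = vector_space scale
  for scale :: "'k::field \<Rightarrow> 'v::ab_group_add \<Rightarrow> 'v" (infixr \<open>*s\<close> 75) +
  fixes V :: "bit \<Rightarrow> 'v set"
  assumes subspace_V: "subspace (V i)"
    and V_sum: "\<exists>a\<in>V 0. \<exists>b\<in>V 1. v = a + b"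
    and V_int: "V 0 \<inter> V 1 = {0}"

locale lie_superalgebra = super_vector_space scale V
  for scale :: "'k::field \<Rightarrow> 'v::ab_group_add \<Rightarrow> 'v" (infixr \<open>*s\<close> 75)
    and V :: "bit \<Rightarrow> 'v set" +
  fixes br :: "'v \<Rightarrow> 'v \<Rightarrow> 'v"
  assumes br_linear_right: "Vector_Spaces.linear scale scale (\<lambda>Y. br X Y)"
    and br_linear_left: "Vector_Spaces.linear scale scale (\<lambda>X. br X Y)"
    and br_even: "\<lbrakk>X \<in> V x; Y \<in> V y\<rbrakk> \<Longrightarrow> br X Y \<in> V (x + y)"
    and br_skew: "\<lbrakk>X \<in> V x; Y \<in> V y\<rbrakk> \<Longrightarrow> br X Y = - (koszul x y *s br Y X)"
    and br_jacobi: "\<lbrakk>X \<in> V x; Y \<in> V y; Z \<in> V z\<rbrakk> \<Longrightarrow>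
      koszul x z *s br X (br Y Z) + koszul x y *s br Y (br Z X) + koszul y z *s br Z (br X Y) = 0"
begin

text \<open>The bracket of two subspaces is the span of the brackets of their elements.\<close>

primrec lower_central :: "nat \<Rightarrow> 'v set" where
  "lower_central 0 = UNIV"
| "lower_central (Suc k) = span {br X Y | X Y. X \<in> lower_central k}"

definition nilpotent :: bool where
  "nilpotent \<longleftrightarrow> (\<exists>k. lower_central k = {0})"

end

context super_vector_space
begin

definition bilinear_form :: "('v \<Rightarrow> 'v \<Rightarrow> 'k) \<Rightarrow> bool" where
  "bilinear_form F \<longleftrightarrow> (\<forall>X. Vector_Spaces.linear scale (*) (\<lambda>Y. F X Y)) \<and>
     (\<forall>Y. Vector_Spaces.linear scale (*) (\<lambda>X. F X Y))"

definition even_form :: "('v \<Rightarrow> 'v \<Rightarrow> 'k) \<Rightarrow> bool" where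
  "even_form F \<longleftrightarrow> (\<forall>X\<in>V 0. \<forall>Y\<in>V 1. F X Y = 0 \<and> F Y X = 0)"

definition nondegenerate_form :: "('v \<Rightarrow> 'v \<Rightarrow> 'k) \<Rightarrow> bool" where
  "nondegenerate_form F \<longleftrightarrow> (\<forall>X. (\<forall>Y. F X Y = 0) \<longrightarrow> X = 0) \<and>
     (\<forall>Y. (\<forall>X. F X Y = 0) \<longrightarrow> Y = 0)"

definition supersymmetric :: "('v \<Rightarrow> 'v \<Rightarrow> 'k) \<Rightarrow> bool" where
  "supersymmetric F \<longleftrightarrow> (\<forall>x y. \<forall>X\<in>V x. \<forall>Y\<in>V y. F X Y = koszul x y * F Y X)"

definition skew_supersymmetric :: "('v \<Rightarrow> 'v \<Rightarrow> 'k) \<Rightarrow> bool" where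
  "skew_supersymmetric F \<longleftrightarrow> (\<forall>x y. \<forall>X\<in>V x. \<forall>Y\<in>V y. F X Y = - (koszul x y * F Y X))"

end

context lie_superalgebra
begin

definition invariant_form :: "('v \<Rightarrow> 'v \<Rightarrow> 'k) \<Rightarrow> bool" where
  "invariant_form F \<longleftrightarrow> (\<forall>X Y Z. F (br X Y) Z = F X (br Y Z))"

definition scalar_2_cocycle :: "('v \<Rightarrow> 'v \<Rightarrow> 'k) \<Rightarrow> bool" where
  "scalar_2_cocycle F \<longleftrightarrow> (\<forall>x y z. \<forall>X\<in>V x. \<forall>Y\<in>V y. \<forall>Z\<in>V z.
     koszul x z * F X (br Y Z) + koszul y x * F Y (br Z X) + koszul z y * F Z (br X Y) = 0)"

definition invariant_scalar_product :: "('v \<Rightarrow> 'v \<Rightarrow> 'k) \<Rightarrow> bool" where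
  "invariant_scalar_product F \<longleftrightarrow> bilinear_form F \<and> even_form F \<and> nondegenerate_form F \<and>
     supersymmetric F \<and> invariant_form F"

definition symplectic_structure :: "('v \<Rightarrow> 'v \<Rightarrow> 'k) \<Rightarrow> bool" where
  "symplectic_structure F \<longleftrightarrow> bilinear_form F \<and> even_form F \<and> nondegenerate_form F \<and>
     skew_supersymmetric F \<and> scalar_2_cocycle F"

end

locale quadratic_symplectic_lie_superalgebra = lie_superalgebra scale V br
  for scale :: "'k::field \<Rightarrow> 'v::ab_group_add \<Rightarrow> 'v" (infixr \<open>*s\<close> 75)
    and V :: "bit \<Rightarrow> 'v set"
    and br :: "'v \<Rightarrow> 'v \<Rightarrow> 'v" +
  fixes B :: "'v \<Rightarrow> 'v \<Rightarrow> 'k" and \<omega> :: "'v \<Rightarrow> 'v \<Rightarrow> 'k"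
  assumes B_invariant_scalar_product: "invariant_scalar_product B"
    and omega_symplectic: "symplectic_structure \<omega>"

end

theory Submission
  imports Defs "HOL-Algebra.Algebraic_Closure_Type" "HOL-Library.Function_Algebras"
begin

text \<open>
  Since both forms are non-degenerate, $\omega(X,Y) = B(D X, Y)$ for an injective even linear map $D$;
  invariance of $B$ and the cocycle identity for $\omega$ make $D$ a derivation. After extension of
  scalars to the algebraic closure the algebra is spanned by the homogeneous elements of the
  generalized eigenspaces of $D$. The bracket maps the eigenspaces of $\lambda$ and $\mu$ into that of
  $\lambda + \mu$, there are only finitely many eigenvalues and none of them is zero, so in characteristic
  zero multiplication by an element of an eigenspace is nilpotent. These elements form a weakly closed
  set in the sense of Jacobson, whose version of Engel's theorem then gives nilpotency.
\<close>

section \<open>Weakly closed sets of nilpotent operators\<close>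

text \<open>Nilpotency is known only for multiplications by homogeneous generalized eigenvectors.
  These do not form a subspace, and a sum of two of them is not obviously nilpotent, so Engel's
  theorem for a linear space of nilpotent operators is out of reach. A weakly closed set need not be
  linear, and the free scalar in its commutators absorbs the Koszul sign. Homogeneity has to be kept
  along with the eigenvalue because this sign belongs to pairs of homogeneous elements. It is the
  non-degeneracy of \<open>\<omega>\<close> that makes \<open>D\<close> injective and so excludes
  the eigenvalue zero. Nilpotency descends from the extended field because the algebra embeds
  injectively and its lower central series maps into iterated products there.\<close>

context vector_space
begin

text \<open>Finiteness is asked only of the spanning set \<open>F\<close>: the extension of scalars
  lives inside a space of functions on the whole algebra, which is in general not
  finite-dimensional.\<close>

lemma dim_psubset_finite:
  assumes "finite F" "W \<subseteq> span F" "subspace U" "U \<subset> W"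
  shows "dim U < dim W"
proof -
  obtain A where A: "A \<subseteq> U" "independent A" "U \<subseteq> span A" "card A = dim U"
    using basis_exists by blast
  obtain w where w: "w \<in> W" "w \<notin> U"
    using assms(4) by blast
  have "span A = U"
    using A assms(3) by (simp add: span_subspace)
  with A w have ind: "independent (insert w A)"
    by (simp add: independent_insert)
  have sub: "insert w A \<subseteq> W"
    using A w assms(4) by auto
  obtain C where C: "insert w A \<subseteq> C" "C \<subseteq> W" "independent C" "W \<subseteq> span C"
    using maximal_independent_subset_extend[OF sub ind] by blast
  have "finite C"
    using independent_span_bound[OF assms(1) C(3)] C(2) assms(2) by blast
  moreover have "w \<notin> A"
    using A w by blast
  ultimately have "card A < card C"
    using C(1) by (metis card_insert_disjoint card_mono finite_insert finite_subset less_eq_Suc_le)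
  moreover have "card C = dim W"
    using C basis_card_eq_dim by blast
  ultimately show ?thesis
    using A by simp
qed

end

text \<open>One product serves twice: \<open>act x\<close> is the operator of \<open>x\<close>, and
  the element \<open>act x y\<close> will stand for a weak commutator of the operators of
  \<open>x\<close> and \<open>y\<close>.\<close>

locale bilinear_product = vector_space scale
  for scale :: "'k::field \<Rightarrow> 'v::ab_group_add \<Rightarrow> 'v" (infixr \<open>*s\<close> 75) +
  fixes act :: "'v \<Rightarrow> 'v \<Rightarrow> 'v"
  assumes act_add_left: "act (x + y) z = act x z + act y z"
    and act_add_right: "act x (y + z) = act x y + act x z"
    and act_scale_left: "act (c *s x) z = c *s act x z"
    and act_scale_right: "act x (c *s z) = c *s act x z"
begin

lemma act_zero_left [simp]: "act 0 z = 0"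
  using act_scale_left[of 0 0 z] by simp

lemma act_zero_right [simp]: "act x 0 = 0"
  using act_scale_right[of x 0 0] by simp

lemma subspace_act_preimage_left: "subspace U \<Longrightarrow> subspace {x. act x z \<in> U}"
  by (rule subspaceI) (auto simp: act_add_left act_scale_left subspace_0 subspace_add subspace_scale)

lemma subspace_act_preimage_right: "subspace U \<Longrightarrow> subspace {z. act x z \<in> U}"
  by (rule subspaceI) (auto simp: act_add_right act_scale_right subspace_0 subspace_add subspace_scale)

lemma act_in_span_right:
  assumes "z \<in> span S" "subspace U" "\<And>s. s \<in> S \<Longrightarrow> act x s \<in> U"
  shows "act x z \<in> U"
  using span_minimal[of S "{z. act x z \<in> U}"] assms subspace_act_preimage_right by blast

lemma act_in_span_left:
  assumes "x \<in> span S" "subspace U" "\<And>s. s \<in> S \<Longrightarrow> act s z \<in> U"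
  shows "act x z \<in> U"
  using span_minimal[of S "{x. act x z \<in> U}"] assms subspace_act_preimage_left by blast

definition act_span :: "'v set \<Rightarrow> 'v set \<Rightarrow> 'v set" where
  "act_span A U = span {act x u | x u. x \<in> A \<and> u \<in> U}"

definition stable :: "'v set \<Rightarrow> 'v set \<Rightarrow> bool" where
  "stable A U \<longleftrightarrow> (\<forall>x\<in>A. \<forall>u\<in>U. act x u \<in> U)"

lemma subspace_act_span [simp]: "subspace (act_span A U)"
  by (simp add: act_span_def)

lemma act_in_act_span: "x \<in> A \<Longrightarrow> u \<in> U \<Longrightarrow> act x u \<in> act_span A U"
  unfolding act_span_def by (rule span_base) blast

lemma act_span_least: "subspace W \<Longrightarrow> (\<And>x u. x \<in> A \<Longrightarrow> u \<in> U \<Longrightarrow> act x u \<in> W) \<Longrightarrow> act_span A U \<subseteq> W"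
  unfolding act_span_def by (rule span_minimal) auto

lemma act_span_mono: "A \<subseteq> A' \<Longrightarrow> U \<subseteq> U' \<Longrightarrow> act_span A U \<subseteq> act_span A' U'"
  unfolding act_span_def by (rule span_mono) auto

lemma act_span_stable: "subspace U \<Longrightarrow> stable A U \<Longrightarrow> act_span A U \<subseteq> U"
  by (rule act_span_least) (auto simp: stable_def)

lemma act_span_pow_mono:
  assumes "A \<subseteq> A'" "U \<subseteq> U'"
  shows "(act_span A ^^ k) U \<subseteq> (act_span A' ^^ k) U'"
  by (induction k) (simp_all add: assms act_span_mono)

lemma act_span_pow_stable:
  assumes "subspace U" "stable A U"
  shows "(act_span A ^^ k) U \<subseteq> U"
proof (induction k)
  case (Suc k)
  then show ?case
    using act_span_mono[OF subset_refl Suc] act_span_stable[OF assms] by auto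
qed simp

lemma subspace_act_span_pow: "subspace U \<Longrightarrow> subspace ((act_span A ^^ k) U)"
  by (cases k) auto

end

text \<open>Jacobson's weakly closed sets: the commutation defect \<open>c\<close> may depend on all three arguments.\<close>

locale weakly_closed = bilinear_product scale act
  for scale :: "'k::field \<Rightarrow> 'v::ab_group_add \<Rightarrow> 'v" (infixr \<open>*s\<close> 75)
    and act :: "'v \<Rightarrow> 'v \<Rightarrow> 'v" +
  fixes F H :: "'v set"
  assumes finite_F: "finite F"
    and H_sub: "H \<subseteq> span F"
    and weak_commute: "\<lbrakk>x \<in> H; y \<in> H; z \<in> span F\<rbrakk> \<Longrightarrow>
      \<exists>c. act (act x y) z = act x (act y z) - c *s act y (act x z)"
    and nil: "x \<in> H \<Longrightarrow> \<exists>n. \<forall>z\<in>span F. (act x ^^ n) z = 0"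
begin

lemma weak_commute_in:
  assumes "x \<in> H" "y \<in> H" "z \<in> span F" "subspace U" "act x (act y z) \<in> U" "act y (act x z) \<in> U"
  shows "act (act x y) z \<in> U"
  using weak_commute[OF assms(1-3)] assms(4-) by (metis subspace_diff subspace_scale)

text \<open>For moving \<open>x\<close> past \<open>y\<close> when the commutator and the reversed
  product are already under control.\<close>

lemma weak_commute_in':
  assumes "x \<in> H" "y \<in> H" "z \<in> span F" "subspace U" "act (act x y) z \<in> U" "act y (act x z) \<in> U"
  shows "act x (act y z) \<in> U"
proof -
  obtain c where "act (act x y) z = act x (act y z) - c *s act y (act x z)"
    using weak_commute[OF assms(1-3)] by blast
  then have "act x (act y z) = act (act x y) z + c *s act y (act x z)"
    by simp
  then show ?thesis
    using assms(4-) by (metis subspace_add subspace_scale)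
qed

text \<open>
  The witness is the set of \<open>x \<in> B\<close> that map every \<open>b\<close>-stable subspace \<open>U\<close> into \<open>b U\<close>; it plays
  the role of the polynomials in \<open>b\<close> without constant term.
\<close>

lemma ex_closed_nilpotent_singleton:
  assumes B: "B \<subseteq> H" "stable B B" and V: "subspace V" "V \<subseteq> span F" "stable B V" and b: "b \<in> B"
  shows "\<exists>G\<subseteq>B. stable G G \<and> b \<in> G \<and> (\<exists>k. (act_span G ^^ k) V \<subseteq> {0})"
proof -
  define good where "good U \<longleftrightarrow> subspace U \<and> U \<subseteq> span F \<and> act b ` U \<subseteq> U" for U
  have img: "good (act b ` U)" if "good U" for U
  proof -
    have U: "subspace U"
      using that by (simp add: good_def)
    have "subspace (act b ` U)"
    proof (rule subspaceI)
      show "0 \<in> act b ` U"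
        using subspace_0[OF U] by (metis act_zero_right imageI)
      show "x + y \<in> act b ` U" if "x \<in> act b ` U" "y \<in> act b ` U" for x y
        using that U by (auto simp flip: act_add_right intro: subspace_add)
      show "c *s x \<in> act b ` U" if "x \<in> act b ` U" for c x
        using that U by (auto simp flip: act_scale_right intro: subspace_scale)
    qed
    then show ?thesis
      using that unfolding good_def by blast
  qed
  define G where "G = {x \<in> B. \<forall>U. good U \<longrightarrow> act x ` U \<subseteq> act b ` U}"
  have "stable G G"
    unfolding stable_def
  proof (intro ballI)
    fix x y assume x: "x \<in> G" and y: "y \<in> G"
    have "act x y \<in> B"
      using x y B(2) by (auto simp: G_def stable_def)
    moreover have "act (act x y) u \<in> act b ` U" if U: "good U" "u \<in> U" for u U
    proof (rule weak_commute_in)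
      show "x \<in> H" "y \<in> H" "u \<in> span F"
        using x y B U by (auto simp: G_def good_def)
      show "subspace (act b ` U)"
        using img[OF U(1)] by (simp add: good_def)
      \<comment> \<open>The inner factor lands in \<open>b U\<close>, which lies in \<open>U\<close>
        again by stability, so the outer factor may be applied.\<close>
      have *: "act p (act q u) \<in> act b ` U" if "p \<in> G" "q \<in> G" for p q
      proof -
        have "act q u \<in> act b ` U"
          using that U unfolding G_def by blast
        then have "act q u \<in> U"
          using U by (auto simp: good_def)
        then show ?thesis
          using that U unfolding G_def by blast
      qed
      show "act x (act y u) \<in> act b ` U" "act y (act x u) \<in> act b ` U"
        using * x y by auto
    qed
    ultimately show "act x y \<in> G"
      by (auto simp: G_def)
  qed
  moreover have "b \<in> G"
    using b by (auto simp: G_def)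
  moreover have "G \<subseteq> B"
    by (auto simp: G_def)
  moreover have "\<exists>k. (act_span G ^^ k) V \<subseteq> {0}"
  proof -
    have good: "good ((image (act b) ^^ k) V)" for k
      by (induction k) (use V b img in \<open>auto simp: good_def stable_def\<close>)
    \<comment> \<open>Each image of \<open>V\<close> under a power of \<open>b\<close> is again
      \<open>b\<close>-stable, so every round of \<open>G\<close> moves one power of
      \<open>b\<close> further.\<close>
    have sub: "(act_span G ^^ k) V \<subseteq> (image (act b) ^^ k) V" for k
    proof (induction k)
      case (Suc k)
      have "act_span G ((act_span G ^^ k) V) \<subseteq> (image (act b) ^^ Suc k) V"
      proof (rule act_span_least)
        show "subspace ((image (act b) ^^ Suc k) V)"
          using good[of "Suc k"] by (simp add: good_def)
        show "act x u \<in> (image (act b) ^^ Suc k) V"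
          if "x \<in> G" "u \<in> (act_span G ^^ k) V" for x u
        proof -
          have "u \<in> (image (act b) ^^ k) V"
            using that Suc by blast
          then show ?thesis
            using that good[of k] unfolding G_def by auto
        qed
      qed
      then show ?case
        by simp
    qed simp
    have im: "(image (act b) ^^ k) V = (act b ^^ k) ` V" for k
      by (induction k) (auto simp: image_image)
    obtain n where "\<forall>z\<in>span F. (act b ^^ n) z = 0"
      using nil b B by blast
    then have "(image (act b) ^^ n) V \<subseteq> {0}"
      using V by (auto simp: im)
    then show ?thesis
      using sub by blast
  qed
  ultimately show ?thesis
    by blast
qed

text \<open>
  Otherwise one could form arbitrarily long products \<open>act (\<dots> (act b c\<^sub>1) \<dots>) c\<^sub>n\<close> outside \<open>D\<close>. Such a
  product acts as a combination of words with \<open>n\<close> factors from \<open>C\<close> and one factor \<open>b\<close>, so for \<open>n = 2 m\<close>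
  at least \<open>m\<close> consecutive factors from \<open>C\<close> occur and the word maps \<open>V\<close> into \<open>M\<close>.
\<close>

lemma ex_normalizing_element:
  assumes B: "B \<subseteq> H" "stable B B" and V: "subspace V" "V \<subseteq> span F" "stable B V"
    and M: "subspace M" "stable B M"
    and C: "C \<subseteq> B" "(act_span C ^^ m) V \<subseteq> M"
    and D: "\<And>b. b \<in> B \<Longrightarrow> (\<forall>v\<in>V. act b v \<in> M) \<Longrightarrow> b \<in> D" and nD: "\<not> B \<subseteq> D"
  shows "\<exists>b\<in>B - D. \<forall>c\<in>C. act b c \<in> D"
proof (rule ccontr)
  assume "\<not> ?thesis"
  then have step: "\<exists>c\<in>C. act b c \<in> B - D" if "b \<in> B - D" for b
    using that B C by (auto simp: stable_def subset_iff)
  obtain b0 where b0: "b0 \<in> B - D"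
    using nD by blast
  \<comment> \<open>Words that apply \<open>q\<close> letters from \<open>C\<close>, then
    \<open>b0\<close>, then \<open>p\<close> more letters from \<open>C\<close>; \<open>Y n\<close>
    admits every position of \<open>b0\<close> among \<open>n\<close> letters.\<close>
  define Z where "Z p q = (act_span C ^^ p) (act_span {b0} ((act_span C ^^ q) V))" for p q
  define Y where "Y n = span {y. \<exists>p q. p + q = n \<and> y \<in> Z p q}" for n
  have VC: "(act_span C ^^ q) V \<subseteq> V" for q
    using act_span_pow_stable[of V C] V C by (auto simp: stable_def)
  have stepY: "act c y \<in> Y (Suc n)" if "c \<in> C" "y \<in> Y n" for c y n
  proof (rule act_in_span_right[OF that(2)[unfolded Y_def]])
    fix s assume "s \<in> {y. \<exists>p q. p + q = n \<and> y \<in> Z p q}"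
    then obtain p q where pq: "p + q = n" "s \<in> Z p q"
      by blast
    then have "act c s \<in> Z (Suc p) q"
      using that by (auto simp: Z_def intro: act_in_act_span)
    with pq show "act c s \<in> Y (Suc n)"
      unfolding Y_def by (intro span_base) force
  qed (simp add: Y_def)
  \<comment> \<open>The index \<open>j\<close> counts letters of \<open>C\<close> already spent on
    the argument. Commuting \<open>c\<close> past \<open>b\<close> produces
    \<open>act b (act c v)\<close>, whose argument has one letter more, so the induction must be
    uniform in \<open>j\<close>.\<close>
  have chain: "\<exists>b\<in>B - D. \<forall>j. \<forall>v\<in>(act_span C ^^ j) V. act b v \<in> Y (k + j)" for k
  proof (induction k)
    case 0
    have "act b0 v \<in> Y j" if "v \<in> (act_span C ^^ j) V" for j v
    proof -
      have "act b0 v \<in> Z 0 j"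
        using that by (auto simp: Z_def intro: act_in_act_span)
      then show ?thesis
        unfolding Y_def by (intro span_base) force
    qed
    with b0 show ?case
      by auto
  next
    case (Suc k)
    then obtain b where b: "b \<in> B - D" "\<And>j v. v \<in> (act_span C ^^ j) V \<Longrightarrow> act b v \<in> Y (k + j)"
      by blast
    obtain c where c: "c \<in> C" "act b c \<in> B - D"
      using step[OF b(1)] by blast
    have "act (act b c) v \<in> Y (Suc k + j)" if v: "v \<in> (act_span C ^^ j) V" for j v
    proof (rule weak_commute_in)
      show "b \<in> H" "c \<in> H" "v \<in> span F"
        using b c B C V VC v by blast+
      show "subspace (Y (Suc k + j))"
        by (simp add: Y_def)
      show "act c (act b v) \<in> Y (Suc k + j)"
        using stepY[OF c(1) b(2)[OF v]] by simp
      have "act c v \<in> (act_span C ^^ Suc j) V"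
        using c v by (auto intro: act_in_act_span)
      from b(2)[OF this] show "act b (act c v) \<in> Y (Suc k + j)"
        by simp
    qed
    with c(2) show ?case
      by blast
  qed
  have CM: "(act_span C ^^ p) M \<subseteq> M" for p
    using act_span_pow_stable[of M C] M C by (auto simp: stable_def)
  have VM: "(act_span C ^^ p) V \<subseteq> M" if "m \<le> p" for p
  proof -
    have "(act_span C ^^ p) V = (act_span C ^^ (p - m)) ((act_span C ^^ m) V)"
      using that by (simp flip: funpow_add comp_apply[of "_ ^^ _"])
    also have "\<dots> \<subseteq> (act_span C ^^ (p - m)) M"
      using C by (intro act_span_pow_mono) auto
    also have "\<dots> \<subseteq> M"
      by (rule CM)
    finally show ?thesis .
  qed
  have ZM: "Z p q \<subseteq> M" if pq: "p + q = 2 * m" for p q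
  \<comment> \<open>A long run applied after \<open>b0\<close> suffices because \<open>b0\<close>
    keeps \<open>V\<close> in \<open>V\<close>; a long run applied before it has already reached
    \<open>M\<close>, and \<open>b0\<close> keeps \<open>M\<close> in \<open>M\<close>.\<close>
  proof (cases "m \<le> p")
    case True
    have "act_span {b0} ((act_span C ^^ q) V) \<subseteq> V"
      using VC[of q] b0 V by (intro act_span_least) (auto simp: stable_def)
    then have "Z p q \<subseteq> (act_span C ^^ p) V"
      unfolding Z_def by (intro act_span_pow_mono) auto
    then show ?thesis
      using VM[OF True] by blast
  next
    case False
    then have "(act_span C ^^ q) V \<subseteq> M"
      using pq by (intro VM) auto
    then have "act_span {b0} ((act_span C ^^ q) V) \<subseteq> M"
      using b0 M by (intro act_span_least) (auto simp: stable_def)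
    then have "Z p q \<subseteq> (act_span C ^^ p) M"
      unfolding Z_def by (intro act_span_pow_mono) auto
    then show ?thesis
      using CM by blast
  qed
  have "Y (2 * m) \<subseteq> M"
    unfolding Y_def using ZM M by (intro span_minimal) auto
  moreover obtain b where b: "b \<in> B - D" "\<forall>j. \<forall>v\<in>(act_span C ^^ j) V. act b v \<in> Y (2 * m + j)"
    using chain by blast
  ultimately have "\<forall>v\<in>V. act b v \<in> M"
    using b(2)[rule_format, of _ 0] by auto
  with D b(1) show False
    by blast
qed

text \<open>Jacobson's theorem for the module \<open>V/M\<close>, phrased with the pair
  \<open>M\<close>, \<open>V\<close> to avoid quotients; induction on its dimension. A maximal
  subset \<open>C\<close> that acts nilpotently but not trivially gives \<open>N = M + C V\<close>
  strictly between \<open>M\<close> and \<open>V\<close>. The stabilizer of \<open>N\<close> in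
  \<open>B\<close> is nilpotent on \<open>V/N\<close> and on \<open>N/M\<close> by induction, hence
  on \<open>V/M\<close>, and maximality of \<open>C\<close> forces it to be all of
  \<open>B\<close>.\<close>

lemma act_span_pow_into:
  assumes "subspace V" "subspace M" "V \<subseteq> span F" "M \<subseteq> V" "B \<subseteq> H" "stable B B" "stable B V" "stable B M"
  shows "\<exists>k. (act_span B ^^ k) V \<subseteq> M"
  using assms
proof (induction "dim V - dim M" arbitrary: V M B rule: less_induct)
  case less
  note V = less.prems(1,3,7) and M = less.prems(2,4,8) and B = less.prems(5,6)
  show ?case
  proof (cases "act_span B V \<subseteq> M")
    case True
    then show ?thesis
      by (intro exI[of _ 1]) simp
  next
    case False
    then obtain b v where b: "b \<in> B" "v \<in> V" "act b v \<notin> M"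
      using act_span_least[of M B V] M by blast
    \<comment> \<open>Nontrivial action on \<open>V/M\<close> is demanded so that \<open>N\<close>
      below exceeds \<open>M\<close>. As \<open>B\<close> may be infinite, a maximal
      \<open>C\<close> is selected by the dimension of its span.\<close>
    define good where "good C \<longleftrightarrow> C \<subseteq> B \<and> stable C C \<and> \<not> act_span C V \<subseteq> M \<and>
      (\<exists>k. (act_span C ^^ k) V \<subseteq> M)" for C
    obtain G where G: "G \<subseteq> B" "stable G G" "b \<in> G" "\<exists>k. (act_span G ^^ k) V \<subseteq> {0}"
      using ex_closed_nilpotent_singleton[OF B V b(1)] by blast
    have "good G"
      unfolding good_def
    proof (intro conjI)
      show "\<not> act_span G V \<subseteq> M"
        using act_in_act_span[OF G(3) b(2)] b(3) by blast
      show "\<exists>k. (act_span G ^^ k) V \<subseteq> M"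
        using G(4) subspace_0[OF M(1)] by blast
    qed (use G in auto)
    moreover have "\<forall>C. good C \<longrightarrow> dim (span C) < Suc (card F)"
      using B H_sub finite_F dim_le_card[of _ F] unfolding good_def less_Suc_eq_le dim_span
      by (meson subset_trans)
    ultimately obtain C where "good C" and C_max: "\<And>C'. good C' \<Longrightarrow> dim (span C') \<le> dim (span C)"
      using ex_has_greatest_nat[of good G "\<lambda>C. dim (span C)" "Suc (card F)"] by blast
    then obtain m where C: "C \<subseteq> B" "stable C C" "\<not> act_span C V \<subseteq> M" "(act_span C ^^ m) V \<subseteq> M"
      by (auto simp: good_def)
    have CV: "act_span C V \<subseteq> V"
      using V C by (intro act_span_stable) (auto simp: stable_def)
    define N where "N = span (M \<union> act_span C V)"
    have N: "subspace N" "M \<subseteq> N" "act_span C V \<subseteq> N"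
      by (auto simp: N_def intro: span_base)
    have NV: "N \<subseteq> V"
      unfolding N_def using M V CV by (intro span_minimal) auto
    \<comment> \<open>A Nakayama argument: \<open>V = M + C V\<close> can be substituted into
      itself, and after \<open>m\<close> rounds \<open>V\<close> would lie in
      \<open>M\<close>.\<close>
    have "N \<noteq> V"
    proof
      assume NV: "N = V"
      have "V \<subseteq> span (M \<union> (act_span C ^^ j) V)" for j
      proof (induction j)
        case 0
        then show ?case
          by (auto intro: span_base)
      next
        case (Suc j)
        have "act_span C V \<subseteq> span (M \<union> (act_span C ^^ Suc j) V)"
        proof (rule act_span_least)
          fix x u assume x: "x \<in> C" and "u \<in> V"
          then have "u \<in> span (M \<union> (act_span C ^^ j) V)"
            using Suc by blast
          then show "act x u \<in> span (M \<union> (act_span C ^^ Suc j) V)"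
          proof (rule act_in_span_right)
            fix s assume "s \<in> M \<union> (act_span C ^^ j) V"
            then show "act x s \<in> span (M \<union> (act_span C ^^ Suc j) V)"
              using x C M by (intro span_base) (auto simp: stable_def intro: act_in_act_span)
          qed simp
        qed simp
        then have "N \<subseteq> span (M \<union> (act_span C ^^ Suc j) V)"
          unfolding N_def by (intro span_minimal) (auto intro: span_base)
        with NV show ?case
          by simp
      qed
      from this[of m] have "V \<subseteq> M"
        using C M by (metis span_minimal subset_refl subset_trans sup.bounded_iff)
      with b M V show False
        by (auto simp: stable_def)
    qed
    with NV have NV': "N \<subset> V"
      by blast
    have MN': "M \<subset> N"
      using N C by blast
    have "N \<subseteq> span F"
      using NV V by simp
    then have dims: "dim M < dim N" "dim N < dim V"
      using dim_psubset_finite[OF finite_F _ M(1) MN'] dim_psubset_finite[OF finite_F V(2) N(1) NV']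
      by simp_all
    define C' where "C' = {b \<in> B. \<forall>n\<in>N. act b n \<in> N}"
    have C': "C' \<subseteq> B" "stable C' N"
      by (auto simp: C'_def stable_def)
    have "C \<subseteq> C'"
    proof
      fix x assume "x \<in> C"
      then have "act x n \<in> N" if "n \<in> N" for n
        using act_in_act_span[of x C n V] that NV N(3) by blast
      with \<open>x \<in> C\<close> C(1) show "x \<in> C'"
        by (auto simp: C'_def)
    qed
    have "stable C' C'"
      unfolding stable_def
    proof (intro ballI)
      fix x y assume xy: "x \<in> C'" "y \<in> C'"
      have "act (act x y) n \<in> N" if "n \<in> N" for n
        using xy B N V NV that C' by (intro weak_commute_in) (auto simp: C'_def)
      then show "act x y \<in> C'"
        using xy B by (auto simp: C'_def stable_def)
    qed
    have "stable C' V" "stable C' M"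
      using V M C' by (auto simp: stable_def)
    obtain k1 where k1: "(act_span C' ^^ k1) V \<subseteq> N"
      using less.hyps[OF _ V(1) N(1) V(2) NV] dims B C' \<open>stable C' C'\<close> \<open>stable C' V\<close>
      by (meson diff_less_mono2 less_trans subset_trans)
    obtain k2 where k2: "(act_span C' ^^ k2) N \<subseteq> M"
      using less.hyps[OF _ N(1) M(1) \<open>N \<subseteq> span F\<close> N(2)] dims B C' \<open>stable C' C'\<close> \<open>stable C' M\<close>
      by (meson diff_less_mono less_imp_le subset_trans)
    have C'_nil: "(act_span C' ^^ (k2 + k1)) V \<subseteq> M"
      using act_span_pow_mono[OF subset_refl k1, where A = C' and k = k2] k2 by (auto simp: funpow_add)
    have "good C'"
      unfolding good_def
    proof (intro conjI)
      show "\<not> act_span C' V \<subseteq> M"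
        using C(3) act_span_mono[OF \<open>C \<subseteq> C'\<close> subset_refl] by blast
    qed (use C' \<open>stable C' C'\<close> C'_nil in blast)+
    \<comment> \<open>Maximality concerns dimensions, so it compares spans and not sets; this is
      enough since the action is linear in the left factor.\<close>
    have "span C' \<subseteq> span C"
    proof (rule ccontr)
      assume "\<not> ?thesis"
      then have "span C \<subset> span C'"
        using span_mono[OF \<open>C \<subseteq> C'\<close>] by blast
      moreover have "span C' \<subseteq> span F"
        using C' B H_sub by (intro span_minimal) auto
      ultimately have "dim (span C) < dim (span C')"
        using dim_psubset_finite[OF finite_F] subspace_span by blast
      with C_max[OF \<open>good C'\<close>] show False
        by simp
    qed
    have "B \<subseteq> C'"
    proof (rule ccontr)
      assume "\<not> B \<subseteq> C'"
      moreover have "b \<in> C'" if "b \<in> B" "\<forall>v\<in>V. act b v \<in> M" for b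
        using that N NV unfolding C'_def by blast
      ultimately obtain b' where b': "b' \<in> B - C'" "\<forall>c\<in>C. act b' c \<in> C'"
        using ex_normalizing_element[OF B V M(1,3) C(1,4), of C'] by blast
      \<comment> \<open>\<open>act b' (act c v)\<close> is \<open>act (act b' c) v\<close> plus a
        multiple of \<open>act c (act b' v)\<close>. As \<open>act b' c\<close> lies in
        \<open>C'\<close>, hence in the span of \<open>C\<close>, both terms fall into
        \<open>C V\<close>.\<close>
      have gen: "act b' s \<in> N" if "s \<in> act_span C V" for s
      proof (rule act_in_span_right[OF that[unfolded act_span_def]])
        fix s assume "s \<in> {act x u |x u. x \<in> C \<and> u \<in> V}"
        then obtain c v where cv: "s = act c v" "c \<in> C" "v \<in> V"
          by blast
        have "act b' c \<in> span C"
          using b'(2) cv(2) \<open>span C' \<subseteq> span C\<close> span_superset by (meson subset_iff)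
        then have "act (act b' c) v \<in> N"
        proof (rule act_in_span_left[OF _ N(1)])
          show "act s v \<in> N" if "s \<in> C" for s
            using act_in_act_span[OF that cv(3)] N(3) by blast
        qed
        moreover have "act b' v \<in> V"
          using cv(3) b'(1) V(3) unfolding stable_def by blast
        then have "act c (act b' v) \<in> N"
          using act_in_act_span[OF cv(2)] N(3) by blast
        moreover have "b' \<in> H" "c \<in> H" "v \<in> span F"
          using cv b' B(1) C(1) V(2) by blast+
        ultimately show "act b' s \<in> N"
          unfolding cv(1) using N(1) weak_commute_in' by blast
      qed (rule N)
      have "act b' n \<in> N" if "n \<in> N" for n
        using that unfolding N_def
      proof (rule act_in_span_right)
        show "act b' s \<in> span (M \<union> act_span C V)" if "s \<in> M \<union> act_span C V" for s
        proof -
          have "act b' s \<in> N"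
            using that gen b' M(3) N(2) unfolding stable_def by blast
          then show ?thesis
            by (simp add: N_def)
        qed
      qed simp
      with b' show False
        by (auto simp: C'_def)
    qed
    then have "(act_span B ^^ (k2 + k1)) V \<subseteq> M"
      using act_span_pow_mono[of B C' V V] C'_nil by blast
    then show ?thesis
      by blast
  qed
qed

end

section \<open>Generalized eigenspaces\<close>

locale linear_operator = vector_space scale
  for scale :: "'k::field \<Rightarrow> 'v::ab_group_add \<Rightarrow> 'v" (infixr \<open>*s\<close> 75) +
  fixes T :: "'v \<Rightarrow> 'v"
  assumes T_add: "T (x + y) = T x + T y"
    and T_scale: "T (c *s x) = c *s T x"
begin

lemma T_zero [simp]: "T 0 = 0"
  using T_scale[of 0 0] by simp

lemma T_diff: "T (x - y) = T x - T y"
  using T_add[of "x - y" y] by (simp add: algebra_simps)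

lemma T_sum: "T (sum f A) = (\<Sum>i\<in>A. T (f i))"
  by (induction A rule: infinite_finite_induct) (simp_all add: T_add)

definition shift :: "'k \<Rightarrow> 'v \<Rightarrow> 'v" where
  "shift l v = T v - l *s v"

lemma shift_zero [simp]: "shift l 0 = 0"
  by (simp add: shift_def)

lemma shift_add: "shift l (x + y) = shift l x + shift l y"
  by (simp add: shift_def T_add scale_right_distrib)

lemma shift_diff: "shift l (x - y) = shift l x - shift l y"
  by (simp add: shift_def T_diff scale_right_diff_distrib)

lemma shift_scale: "shift l (c *s x) = c *s shift l x"
  by (simp add: shift_def T_scale scale_right_diff_distrib mult.commute)

lemma shift_pow_zero [simp]: "(shift l ^^ m) 0 = 0"
  by (induction m) simp_all

lemma shift_pow_add: "(shift l ^^ m) (x + y) = (shift l ^^ m) x + (shift l ^^ m) y"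
  by (induction m) (simp_all add: shift_add)

lemma shift_pow_scale: "(shift l ^^ m) (c *s x) = c *s (shift l ^^ m) x"
  by (induction m) (simp_all add: shift_scale)

definition gen_eigen :: "'k \<Rightarrow> 'v set" where
  "gen_eigen l = {v. \<exists>m. (shift l ^^ m) v = 0}"

lemma gen_eigen_shift_iff: "shift l v \<in> gen_eigen l \<longleftrightarrow> v \<in> gen_eigen l"
proof
  assume "shift l v \<in> gen_eigen l"
  then obtain m where "(shift l ^^ Suc m) v = 0"
    by (auto simp: gen_eigen_def funpow_swap1)
  then show "v \<in> gen_eigen l"
    unfolding gen_eigen_def by blast
next
  assume "v \<in> gen_eigen l"
  then obtain m where "(shift l ^^ m) v = 0"
    by (auto simp: gen_eigen_def)
  then have "(shift l ^^ m) (shift l v) = 0"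
    by (simp flip: funpow_swap1)
  then show "shift l v \<in> gen_eigen l"
    by (auto simp: gen_eigen_def)
qed

text \<open>Local nilpotency of the shift as an induction rule, which spares later proofs the
  bookkeeping of exponents.\<close>

lemma gen_eigen_induct [consumes 1, case_names zero shift]:
  assumes "v \<in> gen_eigen l" and "P 0" and "\<And>v. v \<in> gen_eigen l \<Longrightarrow> P (shift l v) \<Longrightarrow> P v"
  shows "P v"
proof -
  obtain m where "(shift l ^^ m) v = 0"
    using assms(1) by (auto simp: gen_eigen_def)
  then show ?thesis
    using assms(1)
  proof (induction m arbitrary: v)
    case 0
    then show ?case
      using assms(2) by simp
  next
    case (Suc m)
    then show ?case
      using assms(3)[of v] by (simp add: funpow_swap1 gen_eigen_shift_iff)
  qed
qed

lemma subspace_gen_eigen: "subspace (gen_eigen l)"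
proof (rule subspaceI)
  show "0 \<in> gen_eigen l"
    by (auto simp: gen_eigen_def)
  show "c *s x \<in> gen_eigen l" if "x \<in> gen_eigen l" for c x
    using that by (auto simp: gen_eigen_def shift_pow_scale)
  show "x + y \<in> gen_eigen l" if x: "x \<in> gen_eigen l" and y: "y \<in> gen_eigen l" for x y
  proof -
    obtain m n where m: "(shift l ^^ m) x = 0" and n: "(shift l ^^ n) y = 0"
      using x y by (auto simp: gen_eigen_def)
    have "(shift l ^^ (n + m)) x = 0" "(shift l ^^ (m + n)) y = 0"
      using m n by (simp_all add: funpow_add)
    then have "(shift l ^^ (m + n)) (x + y) = 0"
      by (simp add: shift_pow_add add.commute)
    then show ?thesis
      by (auto simp: gen_eigen_def)
  qed
qed

text \<open>The last nonzero vector among the iterated shifts of \<open>v\<close> is an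
  eigenvector.\<close>

lemma ex_eigenvector:
  assumes "v \<in> gen_eigen l" "v \<in> U" "v \<noteq> 0" "subspace U" "T ` U \<subseteq> U"
  shows "\<exists>e\<in>U. e \<noteq> 0 \<and> T e = l *s e"
  using assms(1-3)
proof (induction rule: gen_eigen_induct)
  case (shift v)
  have "shift l v \<in> U"
    using shift.prems(1) assms(4,5) unfolding shift_def by (intro subspace_diff subspace_scale) auto
  then show ?case
    using shift by (cases "shift l v = 0") (auto simp: shift_def)
qed simp

text \<open>Applying \<open>shift \<mu>\<close> to the relation cancels the term of
  \<open>\<mu>\<close> and multiplies each other term by the nonzero \<open>l - \<mu>\<close>,
  leaving a shorter relation.\<close>

lemma eigenvectors_sum_zero:
  assumes "finite \<Lambda>" "\<And>l. l \<in> \<Lambda> \<Longrightarrow> T (e l) = l *s e l" "\<And>l. l \<in> \<Lambda> \<Longrightarrow> e l \<noteq> 0"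
    and "(\<Sum>l\<in>\<Lambda>. c l *s e l) = 0" "l \<in> \<Lambda>"
  shows "c l = 0"
  using assms
proof (induction \<Lambda> arbitrary: c l rule: finite_induct)
  case (insert \<mu> \<Lambda>)
  have "0 = shift \<mu> (\<Sum>l\<in>insert \<mu> \<Lambda>. c l *s e l)"
    unfolding insert.prems(3) by simp
  also have "\<dots> = (\<Sum>l\<in>insert \<mu> \<Lambda>. shift \<mu> (c l *s e l))"
    by (simp add: shift_def T_sum scale_sum_right sum_subtractf del: sum.insert)
  also have "\<dots> = (\<Sum>l\<in>insert \<mu> \<Lambda>. (c l * (l - \<mu>)) *s e l)"
    by (intro sum.cong) (simp_all only: shift_scale, simp_all only: shift_def insert.prems(1)
        flip: scale_left_diff_distrib, simp_all)
  also have "\<dots> = (\<Sum>l\<in>\<Lambda>. (c l * (l - \<mu>)) *s e l)"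
    using insert.hyps by simp
  finally have "c l * (l - \<mu>) = 0" if "l \<in> \<Lambda>" for l
    using insert.IH[of "\<lambda>l. c l * (l - \<mu>)" l] insert.prems that by simp
  then have \<Lambda>: "c l = 0" if "l \<in> \<Lambda>" for l
    using that insert.hyps by auto
  then have "(\<Sum>l\<in>\<Lambda>. c l *s e l) = 0"
    by simp
  then have "c \<mu> = 0"
    using insert.prems insert.hyps by simp
  with \<Lambda> show ?case
    using insert.prems by auto
qed simp

text \<open>Otherwise more than \<open>card F\<close> eigenvectors with distinct eigenvalues, hence
  independent, would fit into the span of \<open>F\<close>.\<close>

lemma finite_gen_eigenvalues:
  assumes "finite F" "T ` span F \<subseteq> span F"
  shows "finite {l. \<not> gen_eigen l \<inter> span F \<subseteq> {0}}"
proof (rule ccontr)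
  assume "infinite {l. \<not> gen_eigen l \<inter> span F \<subseteq> {0}}"
  then obtain \<Lambda> where \<Lambda>: "finite \<Lambda>" "card \<Lambda> = Suc (card F)"
      "\<Lambda> \<subseteq> {l. \<not> gen_eigen l \<inter> span F \<subseteq> {0}}"
    by (meson infinite_arbitrarily_large)
  have "\<exists>e\<in>span F. e \<noteq> 0 \<and> T e = l *s e" if "l \<in> \<Lambda>" for l
    using \<Lambda>(3) that ex_eigenvector[OF _ _ _ subspace_span assms(2), of _ l] by blast
  then obtain e where e: "\<And>l. l \<in> \<Lambda> \<Longrightarrow> e l \<in> span F" "\<And>l. l \<in> \<Lambda> \<Longrightarrow> e l \<noteq> 0"
      "\<And>l. l \<in> \<Lambda> \<Longrightarrow> T (e l) = l *s e l"
    by metis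
  have inj: "inj_on e \<Lambda>"
    by (rule inj_onI) (metis e(2,3) scale_right_imp_eq)
  have "independent (e ` \<Lambda>)"
  proof (rule independent_if_scalars_zero)
    fix f x assume "(\<Sum>x\<in>e ` \<Lambda>. f x *s x) = 0" "x \<in> e ` \<Lambda>"
    then show "f x = 0"
      using eigenvectors_sum_zero[OF \<Lambda>(1) e(3,2), of "\<lambda>l. f (e l)"]
      by (auto simp: sum.reindex[OF inj])
  qed (use \<Lambda> in simp)
  then have "card (e ` \<Lambda>) \<le> card F"
    using independent_span_bound[OF assms(1)] e(1) by blast
  then show False
    using \<Lambda> inj by (simp add: card_image)
qed

section \<open>Polynomials in the operator and spanning by generalized eigenvectors\<close>

definition poly_act :: "'k poly \<Rightarrow> 'v \<Rightarrow> 'v" where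
  "poly_act p v = (\<Sum>i\<le>degree p. coeff p i *s (T ^^ i) v)"

lemma poly_act_eq_sum:
  assumes "degree p \<le> n"
  shows "poly_act p v = (\<Sum>i\<le>n. coeff p i *s (T ^^ i) v)"
  unfolding poly_act_def using assms
  by (intro sum.mono_neutral_left) (auto simp: coeff_eq_0)

lemma poly_act_add: "poly_act (p + q) v = poly_act p v + poly_act q v"
proof -
  let ?n = "max (degree p) (degree q)"
  have "degree (p + q) \<le> ?n"
    by (rule degree_add_le_max)
  then show ?thesis
    by (simp add: poly_act_eq_sum[of _ ?n] scale_left_distrib sum.distrib)
qed

lemma poly_act_smult: "poly_act (smult c p) v = c *s poly_act p v"
  using degree_smult_le[of c p] by (simp add: poly_act_eq_sum[of _ "degree p"] scale_sum_right)

lemma poly_act_pCons_0: "poly_act (pCons 0 p) v = T (poly_act p v)"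
proof -
  have "poly_act (pCons 0 p) v = (\<Sum>i\<le>Suc (degree p). coeff (pCons 0 p) i *s (T ^^ i) v)"
    by (intro poly_act_eq_sum) (rule degree_pCons_le)
  also have "\<dots> = (\<Sum>i\<le>degree p. coeff p i *s (T ^^ Suc i) v)"
    by (simp add: sum.atMost_Suc_shift del: sum.atMost_Suc)
  also have "\<dots> = T (poly_act p v)"
    by (simp add: poly_act_def T_sum T_scale)
  finally show ?thesis .
qed

lemma poly_act_linear_factor: "poly_act ([:- a, 1:] * p) v = shift a (poly_act p v)"
proof -
  have "[:- a, 1:] * p = pCons 0 p + smult (- a) p"
    by simp
  then show ?thesis
    unfolding shift_def by (simp only: poly_act_add poly_act_smult poly_act_pCons_0) simp
qed

lemma poly_act_monom: "poly_act (monom c n) v = c *s (T ^^ n) v"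
proof -
  have "poly_act (monom c n) v = (\<Sum>i\<le>n. (if i = n then c *s (T ^^ n) v else 0))"
    unfolding poly_act_eq_sum[OF degree_monom_le] by (intro sum.cong) auto
  then show ?thesis
    by simp
qed

lemma poly_act_in:
  assumes "subspace U" "T ` U \<subseteq> U" "v \<in> U"
  shows "poly_act p v \<in> U"
proof -
  have "(T ^^ i) v \<in> U" for i
    by (induction i) (use assms in auto)
  then show ?thesis
    unfolding poly_act_def using assms(1) by (intro subspace_sum subspace_scale) auto
qed

text \<open>Without such a polynomial no iterate of \<open>v\<close> depends on the earlier ones,
  and \<open>Suc (card F)\<close> independent vectors would lie in the span of
  \<open>F\<close>.\<close>

lemma ex_annihilating_poly:
  assumes "finite F" "T ` span F \<subseteq> span F" "v \<in> span F"
  shows "\<exists>p. p \<noteq> 0 \<and> poly_act p v = 0"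
proof (rule ccontr)
  assume none: "\<not> ?thesis"
  define A where "A n = (\<lambda>i. (T ^^ i) v) ` {..<n}" for n
  have not_in: "(T ^^ n) v \<notin> span (A n)" for n
  proof
    assume *: "(T ^^ n) v \<in> span (A n)"
    \<comment> \<open>Degree below \<open>n\<close> is expressed by coefficients, so that
      \<open>n = 0\<close> leaves only the zero polynomial.\<close>
    have "subspace {poly_act q v | q. \<forall>i\<ge>n. coeff q i = 0}"
    proof (rule subspaceI)
      show "0 \<in> {poly_act q v | q. \<forall>i\<ge>n. coeff q i = 0}"
        by (auto intro!: exI[of _ 0] simp: poly_act_def)
    next
      fix x y assume "x \<in> {poly_act q v | q. \<forall>i\<ge>n. coeff q i = 0}"
        "y \<in> {poly_act q v | q. \<forall>i\<ge>n. coeff q i = 0}"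
      then obtain p q where "x = poly_act p v" "y = poly_act q v"
          "\<forall>i\<ge>n. coeff (p + q) i = 0"
        by auto
      then show "x + y \<in> {poly_act q v | q. \<forall>i\<ge>n. coeff q i = 0}"
        by (auto simp flip: poly_act_add)
    next
      fix c x assume "x \<in> {poly_act q v | q. \<forall>i\<ge>n. coeff q i = 0}"
      then obtain p where "x = poly_act p v" "\<forall>i\<ge>n. coeff (smult c p) i = 0"
        by auto
      then show "c *s x \<in> {poly_act q v | q. \<forall>i\<ge>n. coeff q i = 0}"
        by (auto simp flip: poly_act_smult)
    qed
    moreover have "A n \<subseteq> {poly_act q v | q. \<forall>i\<ge>n. coeff q i = 0}"
    proof
      fix x assume "x \<in> A n"
      then obtain i where "i < n" "x = poly_act (monom 1 i) v"
        by (auto simp: A_def poly_act_monom)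
      then show "x \<in> {poly_act q v | q. \<forall>i\<ge>n. coeff q i = 0}"
        by (auto intro!: exI[of _ "monom 1 i"])
    qed
    ultimately obtain q where q: "(T ^^ n) v = poly_act q v" "coeff q n = 0"
      using span_minimal * by blast
    let ?p = "monom 1 n + smult (- 1) q"
    have "poly_act ?p v = 0"
      unfolding poly_act_add poly_act_smult poly_act_monom by (simp add: q(1))
    moreover have "coeff ?p n = 1"
      using q by simp
    then have "?p \<noteq> 0"
      by force
    ultimately show False
      using none by blast
  qed
  have "independent (A n) \<and> card (A n) = n" for n
  proof (induction n)
    case 0
    then show ?case
      by (simp add: A_def independent_empty)
  next
    case (Suc n)
    have "A (Suc n) = insert ((T ^^ n) v) (A n)" "finite (A n)"
      by (simp_all add: A_def lessThan_Suc)
    with Suc not_in[of n] show ?case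
      using span_base[of "(T ^^ n) v" "A n"] by (auto simp: independent_insert)
  qed
  moreover have "(T ^^ i) v \<in> span F" for i
    by (induction i) (use assms in auto)
  then have "A (Suc (card F)) \<subseteq> span F"
    by (auto simp: A_def)
  ultimately show False
    using independent_span_bound[OF assms(1)] by (metis Suc_n_not_le_n)
qed

text \<open>On \<open>gen_eigen l\<close> the operator \<open>shift \<mu>\<close> is the nonzero
  scalar \<open>l - \<mu>\<close> plus the locally nilpotent \<open>shift l\<close>, hence
  invertible.\<close>

lemma shift_surj_gen_eigen:
  assumes "w \<in> gen_eigen l" "w \<in> U" "l \<noteq> \<mu>" "subspace U" "T ` U \<subseteq> U"
  shows "\<exists>w'\<in>gen_eigen l \<inter> U. shift \<mu> w' = w"
  using assms(1,2)
proof (induction rule: gen_eigen_induct)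
  case zero
  then show ?case
    using assms(4) subspace_gen_eigen by (intro bexI[of _ 0]) (auto simp: subspace_0)
next
  case (shift w)
  have "shift l w \<in> U"
    using shift.prems assms(4,5) unfolding shift_def by (intro subspace_diff subspace_scale) auto
  with shift.IH obtain u where u: "u \<in> gen_eigen l" "u \<in> U" "shift \<mu> u = shift l w"
    by blast
  \<comment> \<open>Applying \<open>shift \<mu>\<close> to \<open>w - u\<close> gives
    \<open>shift \<mu> w - shift l w\<close>, which is \<open>l - \<mu>\<close> times
    \<open>w\<close>.\<close>
  let ?w' = "inverse (l - \<mu>) *s (w - u)"
  have "?w' \<in> gen_eigen l \<inter> U"
    using u shift assms(4) subspace_gen_eigen by (auto intro!: subspace_scale subspace_diff)
  moreover have "shift \<mu> w - shift l w = (l - \<mu>) *s w"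
    by (simp add: shift_def scale_left_diff_distrib)
  then have "shift \<mu> ?w' = w"
    using assms(3) by (simp add: shift_scale shift_diff u(3))
  ultimately show ?case
    by blast
qed

definition gen_eigen_sum :: "'v set \<Rightarrow> 'v set" where
  "gen_eigen_sum U = span (\<Union>l. gen_eigen l \<inter> U)"

lemma gen_eigen_sum_sub: "subspace U \<Longrightarrow> gen_eigen_sum U \<subseteq> U"
  unfolding gen_eigen_sum_def by (rule span_minimal) auto

text \<open>The components of \<open>shift \<mu> v\<close> for eigenvalues other than
  \<open>\<mu>\<close> have preimages under \<open>shift \<mu>\<close>. Subtracting their sum
  \<open>w\<close> from \<open>v\<close> leaves a vector whose shift lies in
  \<open>gen_eigen \<mu>\<close>, and which therefore lies there itself.\<close>

lemma shift_in_gen_eigen_sum: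
  assumes U: "subspace U" "T ` U \<subseteq> U" and v: "v \<in> U" "shift \<mu> v \<in> gen_eigen_sum U"
  shows "v \<in> gen_eigen_sum U"
proof -
  let ?W = "gen_eigen_sum U"
  let ?P = "{u + shift \<mu> w | u w. u \<in> gen_eigen \<mu> \<inter> U \<and> w \<in> ?W}"
  have W: "subspace ?W"
    by (simp add: gen_eigen_sum_def)
  have S: "subspace (gen_eigen \<mu> \<inter> U)"
    using subspace_gen_eigen U(1) by (rule subspace_inter)
  have "subspace ?P"
  proof (rule subspaceI)
    show "0 \<in> ?P"
      using subspace_0[OF S] subspace_0[OF W] by force
  next
    fix x y assume "x \<in> ?P" "y \<in> ?P"
    then obtain u w u' w' where *: "u \<in> gen_eigen \<mu> \<inter> U" "w \<in> ?W" "u' \<in> gen_eigen \<mu> \<inter> U" "w' \<in> ?W"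
        "x = u + shift \<mu> w" "y = u' + shift \<mu> w'"
      by blast
    then have "x + y = (u + u') + shift \<mu> (w + w')"
      by (simp add: shift_add)
    with * show "x + y \<in> ?P"
      using subspace_add[OF S] subspace_add[OF W] by blast
  next
    fix c x assume "x \<in> ?P"
    then obtain u w where *: "u \<in> gen_eigen \<mu> \<inter> U" "w \<in> ?W" "x = u + shift \<mu> w"
      by blast
    then have "c *s x = c *s u + shift \<mu> (c *s w)"
      by (simp add: shift_scale scale_right_distrib)
    with * show "c *s x \<in> ?P"
      using subspace_scale[OF S] subspace_scale[OF W] by blast
  qed
  moreover have "gen_eigen l \<inter> U \<subseteq> ?P" for l
  proof
    fix x assume x: "x \<in> gen_eigen l \<inter> U"
    show "x \<in> ?P"
    proof (cases "l = \<mu>")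
      case True
      then show ?thesis
        using x subspace_0[OF W] by force
    next
      case False
      then obtain w where w: "w \<in> gen_eigen l \<inter> U" "shift \<mu> w = x"
        using x shift_surj_gen_eigen[OF _ _ False U] by blast
      then have "w \<in> ?W"
        unfolding gen_eigen_sum_def by (blast intro: span_base)
      then show ?thesis
        using w(2) subspace_0[OF S] by force
    qed
  qed
  ultimately have "?W \<subseteq> ?P"
    unfolding gen_eigen_sum_def[of U] by (intro span_minimal) blast+
  then obtain u w where u: "u \<in> gen_eigen \<mu>" "u \<in> U" and w: "w \<in> ?W" "shift \<mu> v = u + shift \<mu> w"
    using v(2) by blast
  have "shift \<mu> (v - w) = u"
    using w by (simp add: shift_diff)
  with u have "v - w \<in> gen_eigen \<mu>"
    by (metis gen_eigen_shift_iff)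
  moreover have "v - w \<in> U"
    using v(1) w(1) gen_eigen_sum_sub[OF U(1)] U(1) by (blast intro: subspace_diff)
  ultimately have "v - w \<in> ?W"
    unfolding gen_eigen_sum_def by (blast intro: span_base)
  then show ?thesis
    using w(1) subspace_add[OF W] by force
qed

end

locale linear_operator_alg_closed = linear_operator scale T
  for scale :: "'k::alg_closed_field \<Rightarrow> 'v::ab_group_add \<Rightarrow> 'v" (infixr \<open>*s\<close> 75)
    and T :: "'v \<Rightarrow> 'v"
begin

text \<open>An annihilating polynomial of \<open>v\<close> splits; stripping its linear factors one
  by one carries membership from zero back to \<open>v\<close>. The subspace \<open>U\<close> is
  general because the decomposition is wanted inside each homogeneous component.\<close>

lemma gen_eigen_sum_eq:
  assumes F: "finite F" "T ` span F \<subseteq> span F" and U: "subspace U" "U \<subseteq> span F" "T ` U \<subseteq> U"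
  shows "gen_eigen_sum U = U"
proof
  show "U \<subseteq> gen_eigen_sum U"
  proof
    fix v assume v: "v \<in> U"
    have W: "subspace (gen_eigen_sum U)"
      by (simp add: gen_eigen_sum_def)
    have "v \<in> gen_eigen_sum U" if "p \<noteq> 0" "poly_act p v \<in> gen_eigen_sum U" for p
      using that
    proof (induction "degree p" arbitrary: p)
      case 0
      then obtain c where c: "p = [:c:]" "c \<noteq> 0"
        using degree0_coeffs[of p] by auto
      then have "c *s v \<in> gen_eigen_sum U"
        using 0 by (simp add: poly_act_def)
      then have "inverse c *s (c *s v) \<in> gen_eigen_sum U"
        by (rule subspace_scale[OF W])
      with c show ?case
        by simp
    next
      case (Suc n)
      then obtain a where "poly p a = 0"
        using alg_closed_imp_poly_has_root[of p] by auto
      then obtain q where q: "p = [:- a, 1:] * q"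
        by (auto simp: poly_eq_0_iff_dvd)
      with Suc.prems have "q \<noteq> 0"
        by auto
      moreover have "degree p = Suc (degree q)"
        unfolding q using \<open>q \<noteq> 0\<close> by (subst degree_mult_eq) auto
      moreover have "poly_act q v \<in> gen_eigen_sum U"
        using Suc.prems(2) shift_in_gen_eigen_sum[OF U(1,3) poly_act_in[OF U(1,3) v]]
        unfolding q poly_act_linear_factor by blast
      ultimately show ?case
        using Suc.hyps by simp
    qed
    moreover obtain p where "p \<noteq> 0" "poly_act p v = 0"
      using ex_annihilating_poly[OF F] U(2) v by blast
    ultimately show "v \<in> gen_eigen_sum U"
      using subspace_0[OF W] by metis
  qed
qed (use U gen_eigen_sum_sub in blast)

end

section \<open>Derivations without eigenvalue zero\<close>

text \<open>The \<open>U i\<close> stand for homogeneous components, the scalar in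
  \<open>graded_commute\<close> leaves room for the Koszul sign, and \<open>T_inj\<close> excludes
  the eigenvalue zero.\<close>

locale graded_derivation = bilinear_product scale act + linear_operator_alg_closed scale T
  for scale :: "'k::{alg_closed_field, field_char_0} \<Rightarrow> 'v::ab_group_add \<Rightarrow> 'v" (infixr \<open>*s\<close> 75)
    and act :: "'v \<Rightarrow> 'v \<Rightarrow> 'v" and T :: "'v \<Rightarrow> 'v" +
  fixes F :: "'v set" and U :: "'i \<Rightarrow> 'v set"
  assumes finite_F: "finite F"
    and subspace_U: "subspace (U i)"
    and U_sub: "U i \<subseteq> span F"
    and span_U: "span F \<subseteq> span (\<Union>i. U i)"
    and T_U: "T ` U i \<subseteq> U i"
    and act_U: "\<exists>k. \<forall>x\<in>U i. \<forall>y\<in>U j. act x y \<in> U k"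
    and leibniz: "\<lbrakk>x \<in> span F; y \<in> span F\<rbrakk> \<Longrightarrow> T (act x y) = act (T x) y + act x (T y)"
    and T_inj: "\<lbrakk>x \<in> span F; T x = 0\<rbrakk> \<Longrightarrow> x = 0"
    and graded_commute: "\<lbrakk>x \<in> U i; y \<in> U j; z \<in> span F\<rbrakk> \<Longrightarrow>
      \<exists>c. act (act x y) z = act x (act y z) - c *s act y (act x z)"
begin

lemma T_span_F: "T ` span F \<subseteq> span F"
proof -
  have "span (\<Union>i. U i) \<subseteq> {x. T x \<in> span F}"
  proof (rule span_minimal)
    show "(\<Union>i. U i) \<subseteq> {x. T x \<in> span F}"
      using T_U U_sub by blast
    show "subspace {x. T x \<in> span F}"
      by (rule subspaceI) (auto simp: T_add T_scale span_zero span_add span_scale)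
  qed
  with span_U show ?thesis
    by blast
qed

lemma act_span_F: 
  assumes "x \<in> span F" "y \<in> span F"
  shows "act x y \<in> span F"
proof (rule act_in_span_left[of _ "\<Union>i. U i"])
  show "x \<in> span (\<Union>i. U i)"
    using assms span_U by blast
  fix s assume s: "s \<in> (\<Union>i. U i)"
  show "act s y \<in> span F"
  proof (rule act_in_span_right[of _ "\<Union>i. U i"])
    show "y \<in> span (\<Union>i. U i)"
      using assms span_U by blast
    show "act s t \<in> span F" if "t \<in> (\<Union>i. U i)" for t
      using s that act_U U_sub by fast
  qed simp
qed simp

text \<open>By the Leibniz rule \<open>shift (l + m)\<close> acts on a product as
  \<open>shift l\<close> on the first factor plus \<open>shift m\<close> on the second. Nested
  inductions over the two factors replace the binomial expansion of its powers.\<close>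

lemma act_gen_eigen:
  assumes "x \<in> gen_eigen l" "y \<in> gen_eigen m" "x \<in> span F" "y \<in> span F"
  shows "act x y \<in> gen_eigen (l + m)"
  using assms
proof (induction arbitrary: y rule: gen_eigen_induct)
  case zero
  then show ?case
    using subspace_0[OF subspace_gen_eigen] by simp
next
  case (shift x)
  note x = shift.prems(2) and IH = shift.IH
  have shift_F: "shift c v \<in> span F" if "v \<in> span F" for c v
    unfolding shift_def using T_span_F that by (blast intro: span_diff span_scale)
  from shift.prems(1,3) show ?case
  proof (induction rule: gen_eigen_induct)
    case zero
    then show ?case
      using subspace_0[OF subspace_gen_eigen] by simp
  next
    case (shift y)
    have "shift (l + m) (act x y) = act (shift l x) y + act x (shift m y)"
    proof -
      have "act (shift l x) y + l *s act x y = act (T x) y"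
        unfolding act_scale_left[symmetric] act_add_left[symmetric] by (simp add: shift_def)
      moreover have "act x (shift m y) + m *s act x y = act x (T y)"
        unfolding act_scale_right[symmetric] act_add_right[symmetric] by (simp add: shift_def)
      ultimately show ?thesis
        unfolding shift_def[of "l + m"] leibniz[OF x shift.prems] scale_left_distrib
        by (metis add_diff_add add_diff_cancel_right')
    qed
    moreover have "act (shift l x) y \<in> gen_eigen (l + m)"
      using IH shift x shift_F by blast
    moreover have "act x (shift m y) \<in> gen_eigen (l + m)"
      using shift shift_F by blast
    ultimately have "shift (l + m) (act x y) \<in> gen_eigen (l + m)"
      using subspace_add[OF subspace_gen_eigen] by simp
    then show ?case
      by (simp only: gen_eigen_shift_iff)
  qed
qed

lemma act_pow_zero [simp]: "(act x ^^ n) 0 = 0"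
  by (induction n) simp_all

lemma gen_eigen_0: "gen_eigen 0 \<inter> span F \<subseteq> {0}"
  using ex_eigenvector[OF _ _ _ subspace_span T_span_F, of _ 0] T_inj by auto

text \<open>Repeated multiplication by \<open>x\<close> moves through the eigenvalues
  \<open>l + k \<mu>\<close>, which are pairwise distinct in characteristic zero, so it must leave
  the finite spectrum.\<close>

lemma act_gen_eigen_nilpotent:
  assumes x: "x \<in> gen_eigen \<mu>" "x \<in> span F"
  shows "\<exists>n. \<forall>z\<in>span F. (act x ^^ n) z = 0"
proof (cases "\<mu> = 0")
  case True
  then have "x = 0"
    using x gen_eigen_0 by blast
  then show ?thesis
    by (intro exI[of _ 1]) simp
next
  case False
  define S where "S = {l. \<not> gen_eigen l \<inter> span F \<subseteq> {0}}"
  have S: "finite S"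
    unfolding S_def by (rule finite_gen_eigenvalues[OF finite_F T_span_F])
  \<comment> \<open>The exponents from 0 to \<open>card S\<close> are one more than the available
    eigenvalues, so this exponent works for all \<open>l\<close> and \<open>z\<close> at
    once.\<close>
  have "(act x ^^ card S) z = 0" if z: "z \<in> gen_eigen l \<inter> span F" for z l
  proof (rule ccontr)
    assume nz: "(act x ^^ card S) z \<noteq> 0"
    have "(act x ^^ k) z \<in> gen_eigen (l + of_nat k * \<mu>) \<inter> span F" for k
    proof (induction k)
      case (Suc k)
      have "act x ((act x ^^ k) z) \<in> gen_eigen (\<mu> + (l + of_nat k * \<mu>))"
        using Suc x by (intro act_gen_eigen) auto
      moreover have "act x ((act x ^^ k) z) \<in> span F"
        using Suc x by (intro act_span_F) auto
      ultimately show ?case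
        by (simp add: algebra_simps)
    qed (use z in simp)
    moreover have "(act x ^^ k) z \<noteq> 0" if "k \<le> card S" for k
    proof
      assume "(act x ^^ k) z = 0"
      then have "(act x ^^ (card S - k + k)) z = 0"
        unfolding funpow_add by simp
      with nz that show False
        by simp
    qed
    ultimately have "(\<lambda>k. l + of_nat k * \<mu>) ` {..card S} \<subseteq> S"
      unfolding S_def by blast
    moreover have "inj_on (\<lambda>k. l + of_nat k * \<mu>) {..card S}"
      using False by (auto intro: inj_onI)
    ultimately have "card {..card S} \<le> card S"
      using S card_inj_on_le by blast
    then show False
      by simp
  qed
  moreover have "subspace {z. (act x ^^ n) z = 0}" for n
  proof (rule subspaceI)
    have "(act x ^^ n) (u + v) = (act x ^^ n) u + (act x ^^ n) v" for u v
      by (induction n) (simp_all add: act_add_right)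
    then show "u + v \<in> {z. (act x ^^ n) z = 0}"
      if "u \<in> {z. (act x ^^ n) z = 0}" "v \<in> {z. (act x ^^ n) z = 0}" for u v
      using that by simp
    have "(act x ^^ n) (c *s u) = c *s (act x ^^ n) u" for c u
      by (induction n) (simp_all add: act_scale_right)
    then show "c *s u \<in> {z. (act x ^^ n) z = 0}" if "u \<in> {z. (act x ^^ n) z = 0}" for c u
      using that by simp
  qed simp
  ultimately have "gen_eigen_sum (span F) \<subseteq> {z. (act x ^^ card S) z = 0}"
    unfolding gen_eigen_sum_def by (intro span_minimal) auto
  then show ?thesis
    using gen_eigen_sum_eq[OF finite_F T_span_F subspace_span subset_refl T_span_F] by blast
qed

theorem act_nilpotent: "\<exists>k. (act_span (span F) ^^ k) (span F) \<subseteq> {0}"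
proof -
  define H where "H = (\<Union>l i. gen_eigen l \<inter> U i)"
  interpret weakly_closed scale act F H
  proof
    show "finite F"
      by (rule finite_F)
    show "H \<subseteq> span F"
      using U_sub by (auto simp: H_def)
    show "\<exists>n. \<forall>z\<in>span F. (act x ^^ n) z = 0" if "x \<in> H" for x
      using that act_gen_eigen_nilpotent U_sub unfolding H_def by blast
    show "\<exists>c. act (act x y) z = act x (act y z) - c *s act y (act x z)"
      if "x \<in> H" "y \<in> H" "z \<in> span F" for x y z
      using that graded_commute unfolding H_def by blast
  qed
  have "stable H H"
    unfolding stable_def
  proof (intro ballI)
    fix x y assume "x \<in> H" "y \<in> H"
    then obtain l i m j where xy: "x \<in> gen_eigen l" "x \<in> U i" "y \<in> gen_eigen m" "y \<in> U j"
      by (auto simp: H_def)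
    then have "act x y \<in> gen_eigen (l + m)"
      using U_sub by (intro act_gen_eigen) auto
    moreover obtain k where "act x y \<in> U k"
      using act_U xy by blast
    ultimately show "act x y \<in> H"
      unfolding H_def by blast
  qed
  moreover have "stable H (span F)"
    using H_sub act_span_F unfolding stable_def by blast
  moreover have "stable H {0}"
    by (simp add: stable_def)
  ultimately obtain k where k: "(act_span H ^^ k) (span F) \<subseteq> {0}"
    using act_span_pow_into[OF subspace_span subspace_single_0 subset_refl _ subset_refl]
    by (meson empty_subsetI insert_subset span_zero)
  have "U i \<subseteq> span H" for i
  proof -
    have "U i = gen_eigen_sum (U i)"
      using gen_eigen_sum_eq[OF finite_F T_span_F subspace_U U_sub T_U] by simp
    also have "\<dots> \<subseteq> span H"
      unfolding gen_eigen_sum_def H_def by (intro span_mono) auto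
    finally show ?thesis .
  qed
  then have "span (\<Union>i. U i) \<subseteq> span H"
    by (intro span_minimal) auto
  with span_U have H: "span F \<subseteq> span H"
    by blast
  \<comment> \<open>Linearity in the left factor lets the spanning set \<open>H\<close> replace the
    whole span.\<close>
  have sub: "act_span (span F) W \<subseteq> act_span H W" for W
  proof (rule act_span_least)
    fix x u assume "x \<in> span F" "u \<in> W"
    then show "act x u \<in> act_span H W"
      using H by (intro act_in_span_left[of x H]) (auto intro: act_in_act_span)
  qed simp
  have "(act_span (span F) ^^ k) (span F) \<subseteq> (act_span H ^^ k) (span F)" for k
  proof (induction k)
    case (Suc k)
    then show ?case
      using sub act_span_mono[OF subset_refl Suc, of H] by auto
  qed simp
  with k show ?thesis
    by blast
qed

end

section \<open>Extension of scalars to the algebraic closure\<close>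

definition lscale :: "'l::field \<Rightarrow> ('v \<Rightarrow> 'l) \<Rightarrow> 'v \<Rightarrow> 'l" where
  "lscale c f = (\<lambda>b. c * f b)"

interpretation L: vector_space lscale
  by unfold_locales (auto simp: lscale_def fun_eq_iff algebra_simps)

text \<open>For transporting identities to the extended field: the defect of a multilinear identity
  is linear in each argument, so its vanishing need only be checked on embedded vectors.\<close>

lemma (in vector_space) subspace_kernelI:
  assumes add: "\<And>x y. d (x + y) = d x + d y" and scale: "\<And>c x. d (scale c x) = scale c (d x)"
  shows "subspace {x. d x = 0}"
  using scale[of 0 0] by (intro subspaceI) (simp_all add: add scale)

text \<open>
  A vector over the algebraic closure is modelled by its coordinates with respect to \<open>Basis\<close>; values of
  the function outside \<open>Basis\<close> are ignored. So \<open>L.span (embed ` Basis)\<close> is the extension of scalars,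
  and \<open>extend S\<close> is the linear extension of a semilinear map \<open>S\<close>.
\<close>

context finite_dimensional_vector_space
begin

definition embed :: "'b \<Rightarrow> 'b \<Rightarrow> 'a alg_closure" where
  "embed v = (\<lambda>b. to_ac (representation Basis v b))"

lemma embed_add: "embed (u + v) = embed u + embed v"
  by (simp add: embed_def fun_eq_iff representation_add independent_Basis span_Basis)

lemma embed_scale: "embed (scale c v) = lscale (to_ac c) (embed v)"
  by (simp add: embed_def lscale_def fun_eq_iff representation_scale independent_Basis span_Basis)

lemma embed_zero: "embed 0 = 0"
  by (simp add: embed_def fun_eq_iff representation_zero)

lemma embed_diff: "embed (u - v) = embed u - embed v"
  using embed_add[of "u - v" v] by (simp add: algebra_simps)

lemma embed_eq_0: "embed v = 0 \<Longrightarrow> v = 0"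
  using sum_representation_eq[OF independent_Basis, of v Basis] finite_Basis
  by (auto simp: embed_def fun_eq_iff span_Basis)

definition extend :: "('b \<Rightarrow> 'b \<Rightarrow> 'a alg_closure) \<Rightarrow> ('b \<Rightarrow> 'a alg_closure) \<Rightarrow> 'b \<Rightarrow> 'a alg_closure" where
  "extend S f = (\<Sum>b\<in>Basis. lscale (f b) (S b))"

lemma extend_add: "extend S (f + g) = extend S f + extend S g"
  by (simp add: extend_def L.scale_left_distrib sum.distrib)

lemma extend_scale: "extend S (lscale c f) = lscale c (extend S f)"
  by (simp add: extend_def L.scale_sum_right) (simp add: lscale_def)

lemma extend_fun_add: "extend (\<lambda>b. S b + S' b) f = extend S f + extend S' f"
  by (simp add: extend_def L.scale_right_distrib sum.distrib)

lemma extend_fun_scale: "extend (\<lambda>b. lscale c (S b)) f = lscale c (extend S f)"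
  by (simp add: extend_def L.scale_sum_right mult.commute)

lemma extend_embed:
  assumes add: "\<And>u v. S (u + v) = S u + S v" and scale: "\<And>c v. S (scale c v) = lscale (to_ac c) (S v)"
  shows "extend S (embed v) = S v"
proof -
  have zero: "S 0 = 0"
    using scale[of 0 0] by simp
  have sum: "S (sum f A) = (\<Sum>i\<in>A. S (f i))" for f :: "'b \<Rightarrow> 'b" and A
    by (induction A rule: infinite_finite_induct) (simp_all add: add zero)
  have "extend S (embed v) = S (\<Sum>b\<in>Basis. scale (representation Basis v b) b)"
    by (simp add: extend_def embed_def sum scale)
  also have "(\<Sum>b\<in>Basis. scale (representation Basis v b) b) = v"
    using sum_representation_eq[OF independent_Basis, of v Basis] finite_Basis span_Basis by auto
  finally show ?thesis .
qed

lemma embed_in_span: "embed v \<in> L.span (embed ` Basis)"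
proof -
  have "embed v = extend embed (embed v)"
    by (simp add: extend_embed embed_add embed_scale)
  also have "\<dots> \<in> L.span (embed ` Basis)"
    unfolding extend_def by (intro L.span_sum L.span_scale L.span_base imageI)
  finally show ?thesis .
qed

section \<open>Linear maps and products over the extended field\<close>

definition extend_map :: "('b \<Rightarrow> 'b) \<Rightarrow> ('b \<Rightarrow> 'a alg_closure) \<Rightarrow> 'b \<Rightarrow> 'a alg_closure" where
  "extend_map T = extend (\<lambda>b. embed (T b))"

definition extend_product ::
  "('b \<Rightarrow> 'b \<Rightarrow> 'b) \<Rightarrow> ('b \<Rightarrow> 'a alg_closure) \<Rightarrow> ('b \<Rightarrow> 'a alg_closure) \<Rightarrow> 'b \<Rightarrow> 'a alg_closure" where
  "extend_product m f g = extend (\<lambda>b. extend_map (m b) g) f"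

lemma extend_map_add: "extend_map T (f + g) = extend_map T f + extend_map T g"
  by (simp add: extend_map_def extend_add)

lemma extend_map_scale: "extend_map T (lscale c f) = lscale c (extend_map T f)"
  by (simp add: extend_map_def extend_scale)

lemma extend_map_embed:
  assumes "Vector_Spaces.linear scale scale T"
  shows "extend_map T (embed v) = embed (T v)"
  using assms unfolding extend_map_def
  by (intro extend_embed) (auto simp: Vector_Spaces.linear_iff embed_add embed_scale)

lemma extend_product_add_left: "extend_product m (f + g) h = extend_product m f h + extend_product m g h"
  by (simp add: extend_product_def extend_add)

lemma extend_product_scale_left: "extend_product m (lscale c f) h = lscale c (extend_product m f h)"
  by (simp add: extend_product_def extend_scale)

lemma extend_product_add_right: "extend_product m f (g + h) = extend_product m f g + extend_product m f h"
  by (simp add: extend_product_def extend_map_add extend_fun_add)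

lemma extend_product_scale_right: "extend_product m f (lscale c h) = lscale c (extend_product m f h)"
  by (simp add: extend_product_def extend_map_scale extend_fun_scale)

lemma extend_product_embed:
  assumes right: "\<And>u. Vector_Spaces.linear scale scale (\<lambda>v. m u v)"
    and left: "\<And>v. Vector_Spaces.linear scale scale (\<lambda>u. m u v)"
  shows "extend_product m (embed u) (embed v) = embed (m u v)"
proof -
  have "extend_product m (embed u) (embed v) = extend (\<lambda>b. embed (m b v)) (embed u)"
    by (simp add: extend_product_def extend_map_embed[OF right])
  also have "\<dots> = embed (m u v)"
    using left[of v] by (intro extend_embed) (auto simp: Vector_Spaces.linear_iff embed_add embed_scale)
  finally show ?thesis .
qed

end

lemma to_ac_koszul [simp]: "to_ac (koszul i j) = koszul i j"
  by (simp add: koszul_def)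

section \<open>Lie superalgebras with an invertible even derivation\<close>

context lie_superalgebra
begin

lemma br_add_left: "br (x + y) z = br x z + br y z"
  and br_scale_left: "br (c *s x) z = c *s br x z"
  using br_linear_left[of z] by (auto simp: Vector_Spaces.linear_iff)

lemma br_add_right: "br x (y + z) = br x y + br x z"
  and br_scale_right: "br x (c *s z) = c *s br x z"
  using br_linear_right[of x] by (auto simp: Vector_Spaces.linear_iff)

lemma br_neg_right: "br x (- z) = - br x z"
  using br_scale_right[of _ "-1"] by simp

text \<open>The Jacobi identity as weak commutation of right multiplications: \<open>P\<close> acts
  on \<open>R\<close> by \<open>br R P\<close>, and the product of \<open>P\<close> and
  \<open>Q\<close> is \<open>br Q P\<close>.\<close>

lemma jacobi_right_homogeneous:
  assumes "P \<in> V x" "Q \<in> V y" "R \<in> V z"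
  shows "br R (br Q P) = br (br R Q) P - koszul x y *s br (br R P) Q"
proof -
  have 1: "br Q R = - (koszul y z *s br R Q)" "br P (br R Q) = - (koszul x (z + y) *s br (br R Q) P)"
    "br Q (br R P) = - (koszul y (z + x) *s br (br R P) Q)" "br P Q = - (koszul x y *s br Q P)"
    using br_skew br_even assms by blast+
  have "koszul x z *s br P (br Q R) + koszul x y *s br Q (br R P) + koszul y z *s br R (br P Q) = 0"
    by (rule br_jacobi[OF assms])
  then show ?thesis
    unfolding 1(1,4) br_neg_right br_scale_right 1(2,3)
    by (cases x; cases y; cases z) (simp_all add: koszul_def algebra_simps)
qed

text \<open>The sign depends only on \<open>x\<close> and \<open>y\<close>, so it is the same for
  both homogeneous components of \<open>R\<close>.\<close>

lemma jacobi_right: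
  assumes "P \<in> V x" "Q \<in> V y"
  shows "br R (br Q P) = br (br R Q) P - koszul x y *s br (br R P) Q"
proof -
  obtain a b where "a \<in> V 0" "b \<in> V 1" "R = a + b"
    using V_sum by blast
  then show ?thesis
    using jacobi_right_homogeneous[OF assms, of a 0] jacobi_right_homogeneous[OF assms, of b 1]
    by (simp add: br_add_left scale_right_distrib)
qed

lemma derivationI:
  assumes D: "\<And>u v. D (u + v) = D u + D v"
    and hom: "\<And>x y P Q. P \<in> V x \<Longrightarrow> Q \<in> V y \<Longrightarrow> D (br P Q) = br (D P) Q + br P (D Q)"
  shows "D (br P Q) = br (D P) Q + br P (D Q)"
proof -
  obtain a b where P: "a \<in> V 0" "b \<in> V 1" "P = a + b"
    using V_sum by blast
  obtain c d where Q: "c \<in> V 0" "d \<in> V 1" "Q = c + d"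
    using V_sum by blast
  show ?thesis
    unfolding P(3) Q(3) br_add_left br_add_right D hom[OF P(1) Q(1)] hom[OF P(1) Q(2)]
      hom[OF P(2) Q(1)] hom[OF P(2) Q(2)] by (simp add: algebra_simps)
qed

end

locale lie_superalgebra_derivation =
  lie_superalgebra scale V br + finite_dimensional_vector_space scale Basis
  for scale :: "'k::field_char_0 \<Rightarrow> 'v::ab_group_add \<Rightarrow> 'v" (infixr \<open>*s\<close> 75)
    and V :: "bit \<Rightarrow> 'v set" and br :: "'v \<Rightarrow> 'v \<Rightarrow> 'v" and Basis :: "'v set" +
  fixes D :: "'v \<Rightarrow> 'v"
  assumes linear_D: "Vector_Spaces.linear scale scale D"
    and D_even: "D ` V i \<subseteq> V i"
    and D_br: "D (br P Q) = br (D P) Q + br P (D Q)"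
    and inj_D: "inj D"
begin

text \<open>\<open>act f\<close> is right multiplication by \<open>f\<close>, since the lower central series brackets on the right.\<close>

definition act :: "('v \<Rightarrow> 'k alg_closure) \<Rightarrow> ('v \<Rightarrow> 'k alg_closure) \<Rightarrow> 'v \<Rightarrow> 'k alg_closure" where
  "act f g = extend_product br g f"

definition grade :: "bit \<Rightarrow> ('v \<Rightarrow> 'k alg_closure) set" where
  "grade i = L.span (embed ` V i)"

lemma act_embed: "act (embed P) (embed Q) = embed (br Q P)"
  unfolding act_def by (rule extend_product_embed[OF br_linear_right br_linear_left])

sublocale ext: bilinear_product lscale act
  by unfold_locales (simp_all add: act_def extend_product_add_left extend_product_add_right
      extend_product_scale_left extend_product_scale_right)

sublocale ext: linear_operator lscale "extend_map D"
  by unfold_locales (simp_all add: extend_map_add extend_map_scale)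

lemma ext_D_embed: "extend_map D (embed v) = embed (D v)"
  by (rule extend_map_embed[OF linear_D])

lemma ext_commute:
  assumes "f \<in> grade i" "g \<in> grade j" "h \<in> L.span (embed ` Basis)"
  shows "act (act f g) h = act f (act g h) - lscale (koszul i j) (act g (act f h))"
proof -
  \<comment> \<open>The defect is freed of embedded arguments one at a time: first \<open>h\<close>,
    then \<open>g\<close>, then \<open>f\<close>.\<close>
  let ?d = "\<lambda>f g h. act (act f g) h - act f (act g h) + lscale (koszul i j) (act g (act f h))"
  have sub: "L.subspace {f. ?d f g h = 0}" "L.subspace {g. ?d f g h = 0}" "L.subspace {h. ?d f g h = 0}"
    for f g h
    by (rule L.subspace_kernelI; simp add: ext.act_add_left ext.act_add_right ext.act_scale_left
        ext.act_scale_right L.scale_right_distrib L.scale_right_diff_distrib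
        L.scale_left_commute[of _ "koszul i j"] add_diff_add add_ac)+
  have "?d (embed P) (embed Q) (embed R) = 0" if "P \<in> V i" "Q \<in> V j" for P Q R
    unfolding act_embed jacobi_right[OF that] embed_diff embed_scale by simp
  then have "?d (embed P) (embed Q) h = 0" if "P \<in> V i" "Q \<in> V j" for P Q
    using that assms(3) L.span_minimal[OF _ sub(3)] by blast
  then have "?d (embed P) g h = 0" if "P \<in> V i" for P
    using that assms(2) L.span_minimal[OF _ sub(2)] unfolding grade_def by blast
  then have "?d f g h = 0"
    using assms(1) L.span_minimal[OF _ sub(1)] unfolding grade_def by blast
  then have "act (act f g) h = - lscale (koszul i j) (act g (act f h)) + act f (act g h)"
    by (simp only: diff_eq_eq flip: eq_neg_iff_add_eq_0)
  then show ?thesis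
    by (simp only: uminus_add_conv_diff)
qed

lemma ext_leibniz:
  assumes "f \<in> L.span (embed ` Basis)" "g \<in> L.span (embed ` Basis)"
  shows "extend_map D (act f g) = act (extend_map D f) g + act f (extend_map D g)"
proof -
  let ?d = "\<lambda>f g. act (extend_map D f) g + act f (extend_map D g) - extend_map D (act f g)"
  have sub: "L.subspace {f. ?d f g = 0}" "L.subspace {g. ?d f g = 0}" for f g
    by (rule L.subspace_kernelI; simp add: ext.act_add_left ext.act_add_right ext.act_scale_left
        ext.act_scale_right ext.T_add ext.T_scale L.scale_right_distrib L.scale_right_diff_distrib)+
  have "?d (embed P) (embed Q) = 0" for P Q
    unfolding act_embed ext_D_embed D_br embed_add by simp
  then have "?d (embed P) g = 0" for P
    using assms(2) L.span_minimal[OF _ sub(2)] by blast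
  then have "?d f g = 0"
    using assms(1) L.span_minimal[OF _ sub(1)] by blast
  then show ?thesis
    by simp
qed

sublocale ext: graded_derivation lscale act "extend_map D" "embed ` Basis" grade
proof
  show "finite (embed ` Basis)"
    using finite_Basis by simp
  show "L.subspace (grade i)" for i
    by (simp add: grade_def)
  show "grade i \<subseteq> L.span (embed ` Basis)" for i
    unfolding grade_def using embed_in_span by (intro L.span_minimal) auto
  show "L.span (embed ` Basis) \<subseteq> L.span (\<Union>i. grade i)"
  proof (rule L.span_minimal)
    show "embed ` Basis \<subseteq> L.span (\<Union>i. grade i)"
    proof safe
      fix v
      obtain a b where ab: "a \<in> V 0" "b \<in> V 1" "v = a + b"
        using V_sum by blast
      have "embed a \<in> grade 0" "embed b \<in> grade 1"
        using ab unfolding grade_def by (auto intro: L.span_base)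
      then show "embed v \<in> L.span (\<Union>i. grade i)"
        unfolding ab(3) embed_add by (intro L.span_add L.span_base) auto
    qed
  qed simp
  show "extend_map D ` grade i \<subseteq> grade i" for i
  proof -
    have "L.subspace {f. extend_map D f \<in> grade i}"
      by (rule L.subspaceI) (simp_all add: ext.T_add ext.T_scale grade_def L.span_zero L.span_add L.span_scale)
    moreover have "embed ` V i \<subseteq> {f. extend_map D f \<in> grade i}"
      using D_even[of i] unfolding grade_def
      by (auto simp: ext_D_embed image_subset_iff intro!: L.span_base)
    ultimately have "grade i \<subseteq> {f. extend_map D f \<in> grade i}"
      unfolding grade_def[of i] by (intro L.span_minimal) auto
    then show ?thesis
      by blast
  qed
  show "\<exists>k. \<forall>f\<in>grade i. \<forall>g\<in>grade j. act f g \<in> grade k" for i j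
  \<comment> \<open>The degrees appear as \<open>j + i\<close> because \<open>act\<close> reverses
    the arguments of the bracket.\<close>
  proof (intro exI[of _ "j + i"] ballI)
    fix f g assume f: "f \<in> grade i" and g: "g \<in> grade j"
    show "act f g \<in> grade (j + i)"
    proof (rule ext.act_in_span_left[OF f[unfolded grade_def]])
      fix s assume s: "s \<in> embed ` V i"
      show "act s g \<in> grade (j + i)"
      proof (rule ext.act_in_span_right[OF g[unfolded grade_def]])
        fix t assume "t \<in> embed ` V j"
        then obtain Q where Q: "Q \<in> V j" "t = embed Q"
          by blast
        obtain P where P: "P \<in> V i" "s = embed P"
          using s by blast
        show "act s t \<in> grade (j + i)"
          unfolding P(2) Q(2) act_embed grade_def using br_even[OF Q(1) P(1)]
          by (intro L.span_base imageI)
      qed (simp add: grade_def)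
    qed (simp add: grade_def)
  qed
  show "extend_map D (act f g) = act (extend_map D f) g + act f (extend_map D g)"
    if "f \<in> L.span (embed ` Basis)" "g \<in> L.span (embed ` Basis)" for f g
    using that by (rule ext_leibniz)
  show "\<exists>c. act (act f g) h = act f (act g h) - lscale c (act g (act f h))"
    if "f \<in> grade i" "g \<in> grade j" "h \<in> L.span (embed ` Basis)" for f g h i j
    using ext_commute[OF that] by blast
  show "f = 0" if f: "f \<in> L.span (embed ` Basis)" "extend_map D f = 0" for f
  proof -
    interpret vector_space_pair scale scale
      by unfold_locales
    \<comment> \<open>Injectivity is not an identity and does not extend by linearity; being
      inverted on the left by a linear map is one, and does.\<close>
    obtain E where E: "Vector_Spaces.linear scale scale E" "E \<circ> D = id"
      using linear_injective_left_inverse[OF linear_D inj_D] by blast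
    have "L.subspace {f. extend_map E (extend_map D f) = f}"
      using extend_map_scale[of E 0 0] by (intro L.subspaceI)
        (simp_all add: ext.T_add ext.T_scale extend_map_add extend_map_scale)
    moreover have "embed ` Basis \<subseteq> {f. extend_map E (extend_map D f) = f}"
      using E(2) by (auto simp: ext_D_embed extend_map_embed[OF E(1)] fun_eq_iff)
    ultimately have "extend_map E (extend_map D f) = f"
      using f(1) L.span_minimal by blast
    moreover have "extend_map E 0 = 0"
      using extend_map_scale[of E 0 0] by simp
    ultimately show "f = 0"
      using f(2) by simp
  qed
qed

theorem nilpotent: nilpotent
proof -
  obtain k where k: "(ext.act_span (L.span (embed ` Basis)) ^^ k) (L.span (embed ` Basis)) \<subseteq> {0}"
    using ext.act_nilpotent by blast
  define W where "W k = (ext.act_span (L.span (embed ` Basis)) ^^ k) (L.span (embed ` Basis))" for k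
  have W: "L.subspace (W k)" for k
    unfolding W_def by (intro ext.subspace_act_span_pow) simp
  \<comment> \<open>Bracketing \<open>P\<close> with \<open>Q\<close> on the right is
    \<open>embed Q\<close> acting on \<open>embed P\<close>, so each term of the series matches one
    more factor.\<close>
  have "lower_central k \<subseteq> {v. embed v \<in> W k}" for k
  proof (induction k)
    case 0
    then show ?case
      by (auto simp: W_def embed_in_span)
  next
    case (Suc k)
    have "subspace {v. embed v \<in> W (Suc k)}"
      using W by (intro subspaceI)
        (simp_all add: embed_zero embed_add embed_scale L.subspace_0 L.subspace_add L.subspace_scale)
    moreover have "embed (br P Q) \<in> W (Suc k)" if "P \<in> lower_central k" for P Q
      using that Suc embed_in_span[of Q] unfolding act_embed[symmetric] W_def
      by (auto intro!: ext.act_in_act_span)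
    ultimately show ?case
      unfolding lower_central.simps by (intro span_minimal) auto
  qed
  then have "lower_central k \<subseteq> {0}"
    using k embed_eq_0 unfolding W_def by blast
  moreover have "0 \<in> lower_central k"
    by (cases k) (simp_all add: span_zero)
  ultimately show ?thesis
    unfolding nilpotent_def by blast
qed

end

section \<open>The derivation relating the two forms\<close>

context finite_dimensional_vector_space
begin

text \<open>Non-degeneracy makes the map from vectors to functionals given by \<open>F\<close>
  injective, hence bijective in finite dimension; \<open>T\<close> is its inverse after the
  corresponding map of \<open>G\<close>.\<close>

lemma ex_linear_representing:
  assumes F: "\<And>P. Vector_Spaces.linear scale (*) (\<lambda>Q. F P Q)" "\<And>Q. Vector_Spaces.linear scale (*) (\<lambda>P. F P Q)"
    and G: "\<And>P. Vector_Spaces.linear scale (*) (\<lambda>Q. G P Q)" "\<And>Q. Vector_Spaces.linear scale (*) (\<lambda>P. G P Q)"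
    and nondeg: "\<And>P. (\<And>Q. F P Q = 0) \<Longrightarrow> P = 0"
  shows "\<exists>T. Vector_Spaces.linear scale scale T \<and> (\<forall>P Q. G P Q = F (T P) Q)"
proof -
  interpret vector_space_pair scale scale
    by unfold_locales
  \<comment> \<open>The dual space is identified with the space itself: a functional becomes the
    vector whose coordinates are its values on \<open>Basis\<close>.\<close>
  define coords where "coords F P = (\<Sum>b\<in>Basis. scale (F P b) b)" for F :: "'b \<Rightarrow> 'b \<Rightarrow> 'a" and P
  have lin: "Vector_Spaces.linear scale scale (coords F)"
    if "\<And>Q. Vector_Spaces.linear scale (*) (\<lambda>P. F P Q)" for F
    using that vector_space_axioms unfolding coords_def Vector_Spaces.linear_iff
    by (simp add: scale_left_distrib sum.distrib scale_sum_right)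
  have eq: "F P Q = G P' Q" if FG: "\<And>P. Vector_Spaces.linear scale (*) (\<lambda>Q. F P Q)"
      "\<And>P. Vector_Spaces.linear scale (*) (\<lambda>Q. G P Q)" and eq: "coords F P = coords G P'" for F G P P' Q
  proof -
    have rep: "representation Basis (coords F P) b = F P b" if "b \<in> Basis" for F P b
      unfolding coords_def using that finite_Basis
      by (simp add: representation_sum representation_scale representation_basis independent_Basis
          span_Basis if_distrib cong: if_cong)
    have b: "F P b = G P' b" if "b \<in> Basis" for b
      using rep[OF that] eq by metis
    have zero: "h 0 = 0" if "Vector_Spaces.linear scale (*) h" for h
    proof -
      have "h (scale 0 0) = 0 * h 0"
        using that unfolding Vector_Spaces.linear_iff by blast
      then show ?thesis
        by simp
    qed
    have "subspace {Q. F P Q = G P' Q}"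
      using FG(1)[of P] FG(2)[of P'] zero[OF FG(1), of P] zero[OF FG(2), of P']
      unfolding Vector_Spaces.linear_iff by (intro subspaceI) simp_all
    with b have "span Basis \<subseteq> {Q. F P Q = G P' Q}"
      by (intro span_minimal) auto
    then show ?thesis
      using span_Basis by auto
  qed
  have "inj (coords F)"
  proof (rule injI)
    fix P P' assume "coords F P = coords F P'"
    then have "F P Q = F P' Q" for Q
      by (rule eq[OF F(1) F(1)])
    moreover have "F P Q = F (P - P') Q + F P' Q" for Q
    proof -
      have "F ((P - P') + P') Q = F (P - P') Q + F P' Q"
        using F(2)[of Q] unfolding Vector_Spaces.linear_iff by blast
      then show ?thesis
        by simp
    qed
    ultimately have "F (P - P') Q = 0" for Q
      by (metis add_cancel_left_left)
    then have "P - P' = 0"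
      by (rule nondeg)
    then show "P = P'"
      by simp
  qed
  have lin_F: "Vector_Spaces.linear scale scale (coords F)"
    by (rule lin[OF F(2)])
  then have "surj (coords F)"
    using linear_inj_imp_surj \<open>inj (coords F)\<close> by blast
  then obtain S where S: "Vector_Spaces.linear scale scale S" "coords F \<circ> S = id"
    using linear_surjective_right_inverse[OF lin_F] by blast
  have "Vector_Spaces.linear scale scale (S \<circ> coords G)"
    using lin[OF G(2)] S(1) by (rule Vector_Spaces.linear_compose)
  moreover have "G P Q = F ((S \<circ> coords G) P) Q" for P Q
  proof (rule eq[OF G(1) F(1)])
    show "coords G P = coords F ((S \<circ> coords G) P)"
      using S(2) by (simp add: fun_eq_iff)
  qed
  ultimately show ?thesis
    by blast
qed

end

theorem corollary4p1:
  fixes scale :: "'k::field_char_0 \<Rightarrow> 'v::ab_group_add \<Rightarrow> 'v"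
    and Basis :: "'v set"
    and V :: "bit \<Rightarrow> 'v set"
    and br :: "'v \<Rightarrow> 'v \<Rightarrow> 'v"
    and B \<omega> :: "'v \<Rightarrow> 'v \<Rightarrow> 'k"
  assumes "finite_dimensional_vector_space scale Basis"
    and "quadratic_symplectic_lie_superalgebra scale V br B \<omega>"
  shows "lie_superalgebra.nilpotent scale br"
proof -
  interpret finite_dimensional_vector_space scale Basis
    by (rule assms)
  interpret quadratic_symplectic_lie_superalgebra scale V br B \<omega>
    by (rule assms)
  note B = B_invariant_scalar_product[unfolded invariant_scalar_product_def]
  note w = omega_symplectic[unfolded symplectic_structure_def]
  have B_lin: "Vector_Spaces.linear scale (*) (\<lambda>Q. B P Q)" "Vector_Spaces.linear scale (*) (\<lambda>P. B P Q)"
    and w_lin: "Vector_Spaces.linear scale (*) (\<lambda>Q. \<omega> P Q)" "Vector_Spaces.linear scale (*) (\<lambda>P. \<omega> P Q)"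
    for P Q
    using B w by (simp_all add: bilinear_form_def)
  have B_add: "B (P + P') Q = B P Q + B P' Q" "B P (Q + Q') = B P Q + B P Q'"
    and B_scale: "B (scale c P) Q = c * B P Q" "B P (scale c Q) = c * B P Q" for P P' Q Q' c
    using B_lin[of P] B_lin(2)[of Q] by (simp_all add: Vector_Spaces.linear_iff)
  have B_neg: "B P (- Q) = - B P Q" "B (- P) Q = - B P Q" for P Q
    using B_scale(1)[of "-1" P Q] B_scale(2)[of P "-1" Q] by simp_all
  have B_nondeg: "P = 0" if "\<And>Q. B P Q = 0" for P
    using that B by (simp add: nondegenerate_form_def)
  have w_nondeg: "P = 0" if "\<And>Q. \<omega> P Q = 0" for P
    using that w by (simp add: nondegenerate_form_def)
  have B_inv: "B (br P Q) R = B P (br Q R)" for P Q R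
    using B by (simp add: invariant_form_def)
  have w_skew: "\<omega> P Q = - (koszul x y * \<omega> Q P)" if "P \<in> V x" "Q \<in> V y" for P Q x y
    using that w unfolding skew_supersymmetric_def by blast
  have w_cocycle: "koszul x z * \<omega> P (br Q R) + koszul y x * \<omega> Q (br R P) + koszul z y * \<omega> R (br P Q) = 0"
    if "P \<in> V x" "Q \<in> V y" "R \<in> V z" for P Q R x y z
    using that w unfolding scalar_2_cocycle_def by blast
  have even: "F P Q = 0" if "even_form F" "P \<in> V x" "Q \<in> V y" "x \<noteq> y" for F :: "'v \<Rightarrow> 'v \<Rightarrow> 'k" and P Q x y
    using that unfolding even_form_def by (cases x; cases y) auto
  obtain D where D: "Vector_Spaces.linear scale scale D" "\<And>P Q. \<omega> P Q = B (D P) Q"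
    using ex_linear_representing[OF B_lin w_lin B_nondeg] by blast
  have D_add: "D (P + Q) = D P + D Q" for P Q
    using D(1) by (simp add: Vector_Spaces.linear_iff)
  have D_even: "D P \<in> V i" if P: "P \<in> V i" for P i
  proof -
    have split: "\<exists>a\<in>V i. \<exists>b\<in>V (i + 1). v = a + b" for v
    proof (cases i)
      case zero
      then show ?thesis
        using V_sum[of v] by simp
    next
      case one
      obtain a b where "a \<in> V 0" "b \<in> V 1" "v = b + a"
        using V_sum[of v] add.commute by metis
      with one show ?thesis
        by auto
    qed
    obtain a b where ab: "a \<in> V i" "b \<in> V (i + 1)" "D P = a + b"
      using split[of "D P"] by blast
    \<comment> \<open>The component \<open>b\<close> of \<open>D P\<close> of the wrong degree is
      orthogonal to everything: to \<open>c\<close> by evenness of \<open>B\<close>, and to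
      \<open>d\<close> because both \<open>B (D P) d\<close>, which is \<open>\<omega> P d\<close>,
      and \<open>B a d\<close> vanish.\<close>
    have "B b Q = 0" for Q
    proof -
      obtain c d where cd: "c \<in> V i" "d \<in> V (i + 1)" "Q = c + d"
        using split[of Q] by blast
      have ne: "i \<noteq> i + 1" "i + 1 \<noteq> i"
        by simp_all
      have Be: "even_form B" and we: "even_form \<omega>"
        using B w by blast+
      have "B b c = 0" "B a d = 0" "B (D P) d = 0"
        using even[OF Be ab(2) cd(1) ne(2)] even[OF Be ab(1) cd(2) ne(1)] even[OF we P cd(2) ne(1)]
        by (simp_all flip: D(2))
      then show ?thesis
        by (simp add: ab(3) cd(3) B_add)
    qed
    then have "b = 0"
      by (rule B_nondeg)
    with ab show ?thesis
      by simp
  qed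
  have "D (br P Q) = br (D P) Q + br P (D Q)" if P: "P \<in> V x" and Q: "Q \<in> V y" for P Q x y
  proof -
    have hom: "B (br (D P) Q + br P (D Q) - D (br P Q)) R = 0" if R: "R \<in> V z" for R z
    proof -
      have 1: "\<omega> P (br Q R) = B (br (D P) Q) R"
        by (simp add: D(2) B_inv)
      have "\<omega> Q (br R P) = - (koszul z x * B (br (D Q) P) R)"
        unfolding D(2) br_skew[OF R P] by (simp add: B_neg B_scale B_inv)
      also have "\<dots> = koszul z x * koszul y x * B (br P (D Q)) R"
        unfolding br_skew[OF D_even[OF Q] P] by (simp add: B_neg B_scale)
      finally have 2: "\<omega> Q (br R P) = koszul z x * koszul y x * B (br P (D Q)) R" .
      have 3: "\<omega> R (br P Q) = - (koszul z (x + y) * B (D (br P Q)) R)"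
        using w_skew[OF R br_even[OF P Q]] by (simp add: D(2))
      \<comment> \<open>Since \<open>koszul y x\<close> squares to 1 and
        \<open>koszul z y * koszul z (x + y)\<close> equals \<open>koszul z x\<close>, all three
        terms share the sign \<open>koszul x z\<close> up to the minus of the last one.\<close>
      have "koszul x z * B (br (D P) Q) R + koszul y x * (koszul z x * koszul y x * B (br P (D Q)) R)
          + koszul z y * - (koszul z (x + y) * B (D (br P Q)) R) = 0"
        using w_cocycle[OF P Q R] unfolding 1 2 3 .
      then show ?thesis
        unfolding diff_conv_add_uminus B_add B_neg
        by (cases x; cases y; cases z) (simp_all add: koszul_def algebra_simps)
    qed
    have "B (br (D P) Q + br P (D Q) - D (br P Q)) R = 0" for R
    proof -
      obtain a b where "a \<in> V 0" "b \<in> V 1" "R = a + b"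
        using V_sum by blast
      then show ?thesis
        using hom by (simp add: B_add(2))
    qed
    then have "br (D P) Q + br P (D Q) - D (br P Q) = 0"
      by (rule B_nondeg)
    then show ?thesis
      by simp
  qed
  then have D_br: "D (br P Q) = br (D P) Q + br P (D Q)" for P Q
    using derivationI D_add by blast
  have "inj D"
  proof (rule injI)
    fix P Q assume "D P = D Q"
    then have "D (P - Q) = 0"
      using D_add[of "P - Q" Q] by simp
    then have "\<omega> (P - Q) R = 0" for R
      using B_scale(1)[of 0 0 R] by (simp add: D(2))
    then show "P = Q"
      using w_nondeg by (metis eq_iff_diff_eq_0)
  qed
  have "lie_superalgebra_derivation scale V br Basis D"
  proof (intro lie_superalgebra_derivation.intro lie_superalgebra_derivation_axioms.intro)
    show "D ` V i \<subseteq> V i" for i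
      using D_even by blast
  qed (fact lie_superalgebra_axioms finite_dimensional_vector_space_axioms D(1) D_br \<open>inj D\<close>)+
  then show ?thesis
    by (rule lie_superalgebra_derivation.nilpotent)
qed

end
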